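(* Let $M$ be the coassociative chain coalgebra over $\mathbf F_2$ with basis $\{1_0,u_2,x_3,y_3,z_3,v_4,w_6\}$ (subscripts denote degree), whose only nonzero differential on basis elements is $\partial v=x+y$, and whose reduced coproduct $\bar\psi$ is given by $\bar\psi(v)=u\otimes u$, $\bar\psi(w)=x\otimes z+z\otimes y$, with $u,x,y,z$ primitive. Then $M$ is not realizable, i.e., $M$ is not of the same homotopy type as $C_*(X;\mathbf F_2)$ for any space $X$.
   Context: The full coproduct is $\psi(a)=a\otimes1+1\otimes a+\bar\psi(a)$ for basis elements $a\ne1$, and $\psi(1)=1\otimes1$; "primitive" means $\bar\psi(a)=0$. $C_*(X;\mathbf F_2)$ is the (normalized) chain coalgebra of $X$ with coefficients in $\mathbf F_2$, with the usual Alexander–Whitney coproduct. Two chain coalgebras are of the same homotopy type if they are connected by a finite zigzag of quasi-isomorphisms of chain coalgebras. *)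

theory Defs
  imports "HOL-Homology.Simplices" "HOL-Library.Z2"
begin

section \<open>Linear algebra over the field with two elements\<close>

text \<open>
  A vector space over \<open>F\<^sub>2\<close> is given by a basis: the space with basis \<open>B \<subseteq> UNIV :: 'b set\<close> is the
  set of all \<open>c :: 'b \<Rightarrow>\<^sub>0 bit\<close> whose support lies in \<open>B\<close>. Every vector space over a field has a
  basis, so nothing is lost. Linear maps are arbitrary (they need not respect the bases) and are
  given by the images of the basis elements; the tensor product of the spaces on \<open>A\<close> and \<open>B\<close>
  is the space on \<open>A \<times> B\<close>.
\<close>

type_synonym 'b vec2 = "'b \<Rightarrow>\<^sub>0 bit"

definition gen :: "'b \<Rightarrow> 'b vec2" where
  "gen b = Poly_Mapping.single b 1"

text \<open>Linear extension. No scalars occur in the sum because the nonzero coefficients are all 1.\<close>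

definition lin :: "('a \<Rightarrow> 'v::comm_monoid_add) \<Rightarrow> 'a vec2 \<Rightarrow> 'v" where
  "lin f c = (\<Sum>b\<in>Poly_Mapping.keys c. f b)"

definition tens :: "'a vec2 \<Rightarrow> 'b vec2 \<Rightarrow> ('a \<times> 'b) vec2" (infixr \<open>\<otimes>\<^sub>2\<close> 75) where
  "u \<otimes>\<^sub>2 v = lin (\<lambda>a. lin (\<lambda>b. gen (a, b)) v) u"

definition tens_map ::
    "('a \<Rightarrow> 'c vec2) \<Rightarrow> ('b \<Rightarrow> 'd vec2) \<Rightarrow> ('a \<times> 'b) vec2 \<Rightarrow> ('c \<times> 'd) vec2" where
  "tens_map f g = lin (\<lambda>(a, b). f a \<otimes>\<^sub>2 g b)"

definition assoc_map :: "(('a \<times> 'b) \<times> 'c) vec2 \<Rightarrow> ('a \<times> 'b \<times> 'c) vec2" where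
  "assoc_map = lin (\<lambda>((a, b), c). gen (a, b, c))"


section \<open>Chain coalgebras\<close>

record 'b coalg =
  basis :: "'b set"
  deg :: "'b \<Rightarrow> nat"
  bd :: "'b \<Rightarrow> 'b vec2"
  coprod :: "'b \<Rightarrow> ('b \<times> 'b) vec2"
  counit :: "'b \<Rightarrow> bit"

definition chains :: "'b coalg \<Rightarrow> nat \<Rightarrow> 'b vec2 set" where
  "chains C n = {c. Poly_Mapping.keys c \<subseteq> {b \<in> basis C. deg C b = n}}"

definition tensor_chains :: "'b coalg \<Rightarrow> nat \<Rightarrow> ('b \<times> 'b) vec2 set" where
  "tensor_chains C n =
     {c. Poly_Mapping.keys c \<subseteq> {(a, b). a \<in> basis C \<and> b \<in> basis C \<and> deg C a + deg C b = n}}"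

text \<open>
  Coassociative counital differential graded coalgebras over \<open>F\<^sub>2\<close>, concentrated in nonnegative
  degrees. There are no signs in characteristic 2.
\<close>

definition chain_coalgebra :: "'b coalg \<Rightarrow> bool" where
  "chain_coalgebra C \<longleftrightarrow>
     (\<forall>b\<in>basis C.
        (deg C b = 0 \<longrightarrow> bd C b = 0) \<and>
        (\<forall>n. deg C b = Suc n \<longrightarrow> bd C b \<in> chains C n) \<and>
        lin (bd C) (bd C b) = 0 \<and>
        coprod C b \<in> tensor_chains C (deg C b) \<and>
        lin (coprod C) (bd C b) =
          tens_map (bd C) gen (coprod C b) + tens_map gen (bd C) (coprod C b) \<and>
        assoc_map (tens_map (coprod C) gen (coprod C b)) =
          tens_map gen (coprod C) (coprod C b) \<and>
        (deg C b \<noteq> 0 \<longrightarrow> counit C b = 0) \<and>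
        lin (counit C) (bd C b) = 0 \<and>
        lin (\<lambda>(x, y). if counit C x = 1 then gen y else 0) (coprod C b) = gen b \<and>
        lin (\<lambda>(x, y). if counit C y = 1 then gen x else 0) (coprod C b) = gen b)"

definition coalg_hom :: "'a coalg \<Rightarrow> 'b coalg \<Rightarrow> ('a \<Rightarrow> 'b vec2) \<Rightarrow> bool" where
  "coalg_hom C D f \<longleftrightarrow>
     (\<forall>b\<in>basis C.
        f b \<in> chains D (deg C b) \<and>
        lin f (bd C b) = lin (bd D) (f b) \<and>
        tens_map f f (coprod C b) = lin (coprod D) (f b) \<and>
        lin (counit D) (f b) = counit C b)"


section \<open>Homology and homotopy type\<close>

definition cycles :: "'b coalg \<Rightarrow> nat \<Rightarrow> 'b vec2 set" where
  "cycles C n = {c \<in> chains C n. lin (bd C) c = 0}"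

definition boundaries :: "'b coalg \<Rightarrow> nat \<Rightarrow> 'b vec2 set" where
  "boundaries C n = lin (bd C) ` chains C (Suc n)"

definition homology_class :: "'b coalg \<Rightarrow> nat \<Rightarrow> 'b vec2 \<Rightarrow> 'b vec2 set" where
  "homology_class C n z = {z' \<in> cycles C n. z' - z \<in> boundaries C n}"

definition homology :: "'b coalg \<Rightarrow> nat \<Rightarrow> 'b vec2 set set" where
  "homology C n = homology_class C n ` cycles C n"

definition homology_map ::
    "'b coalg \<Rightarrow> nat \<Rightarrow> ('a \<Rightarrow> 'b vec2) \<Rightarrow> 'a vec2 set \<Rightarrow> 'b vec2 set" where
  "homology_map D n f K = (\<Union>z\<in>K. homology_class D n (lin f z))"

definition quasi_iso :: "'a coalg \<Rightarrow> 'b coalg \<Rightarrow> ('a \<Rightarrow> 'b vec2) \<Rightarrow> bool" where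
  "quasi_iso C D f \<longleftrightarrow>
     coalg_hom C D f \<and> (\<forall>n. bij_betw (homology_map D n f) (homology C n) (homology D n))"

definition qi_linked :: "'a coalg \<Rightarrow> 'b coalg \<Rightarrow> bool" where
  "qi_linked C D \<longleftrightarrow> (\<exists>f. quasi_iso C D f) \<or> (\<exists>g. quasi_iso D C g)"

text \<open>
  A finite zigzag \<open>C - E 0 - \<dots> - E n - D\<close> of quasi-isomorphisms in either direction. HOL cannot
  quantify over types inside a formula, so the basis elements of the intermediate coalgebras are
  drawn from one type \<open>'c\<close>, given as an argument. Any particular zigzag has only finitely many
  intermediate coalgebras and so fits into a suitable \<open>'c\<close> (for instance a sum type); a theorem
  denying \<open>same_homotopy_type TYPE('c) C D\<close> with \<open>'c\<close> a type variable therefore excludes all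
  zigzags.
\<close>

definition same_homotopy_type :: "'c itself \<Rightarrow> 'a coalg \<Rightarrow> 'b coalg \<Rightarrow> bool" where
  "same_homotopy_type T C D \<longleftrightarrow>
     (\<exists>(n::nat) (E :: nat \<Rightarrow> 'c coalg).
        (\<forall>i\<le>n. chain_coalgebra (E i)) \<and>
        qi_linked C (E 0) \<and> (\<forall>i<n. qi_linked (E i) (E (Suc i))) \<and> qi_linked (E n) D)"


section \<open>The normalized singular chain coalgebra of a space\<close>

text \<open>
  A singular simplex is paired with its dimension. Normalized chains are singular chains modulo
  the span of the degenerate simplices; the classes of the nondegenerate simplices form a basis
  of this quotient, and \<open>nd_class\<close> is the quotient map on simplices.
\<close>

type_synonym 'a simplex = "nat \<times> ((nat \<Rightarrow> real) \<Rightarrow> 'a)"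

text \<open>The map from the standard \<open>Suc p\<close>-simplex to the standard \<open>p\<close>-simplex that identifies the
  vertices \<open>j\<close> and \<open>Suc j\<close>, in barycentric coordinates.\<close>

definition simplicial_degen :: "nat \<Rightarrow> (nat \<Rightarrow> real) \<Rightarrow> nat \<Rightarrow> real" where
  "simplicial_degen j t =
     (\<lambda>k. if k < j then t k else if k = j then t j + t (Suc j) else t (Suc k))"

definition degenerate :: "'a topology \<Rightarrow> 'a simplex \<Rightarrow> bool" where
  "degenerate X s \<longleftrightarrow>
     (\<exists>p \<tau> j. j \<le> p \<and> singular_simplex p X \<tau> \<and>
        s = (Suc p, restrict (\<tau> \<circ> simplicial_degen j) (standard_simplex (Suc p))))"

definition nd_class :: "'a topology \<Rightarrow> 'a simplex \<Rightarrow> 'a simplex vec2" where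
  "nd_class X s = (if degenerate X s then 0 else gen s)"

text \<open>The faces on the first \<open>i + 1\<close> and on the last \<open>p - i + 1\<close> vertices. For the front face,
  note that \<open>standard_simplex i \<subseteq> standard_simplex p\<close> for \<open>i \<le> p\<close>.\<close>

definition front_face :: "nat \<Rightarrow> 'a simplex \<Rightarrow> 'a simplex" where
  "front_face i = (\<lambda>(p, \<sigma>). (i, restrict \<sigma> (standard_simplex i)))"

definition back_face :: "nat \<Rightarrow> 'a simplex \<Rightarrow> 'a simplex" where
  "back_face i = (\<lambda>(p, \<sigma>).
     (p - i, restrict (\<lambda>t. \<sigma> (\<lambda>k. if k < i then 0 else t (k - i))) (standard_simplex (p - i))))"

definition normalized_chains :: "'a topology \<Rightarrow> 'a simplex coalg" where
  "normalized_chains X =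
     \<lparr> basis = {(p, \<sigma>). singular_simplex p X \<sigma> \<and> \<not> degenerate X (p, \<sigma>)},
       deg = fst,
       bd = (\<lambda>(p, \<sigma>). if p = 0 then 0
                      else (\<Sum>k\<le>p. nd_class X (p - 1, singular_face p k \<sigma>))),
       coprod = (\<lambda>s. \<Sum>i\<le>fst s. nd_class X (front_face i s) \<otimes>\<^sub>2 nd_class X (back_face i s)),
       counit = (\<lambda>s. if fst s = 0 then 1 else 0) \<rparr>"


section \<open>The coalgebra \<open>M\<close>\<close>

datatype M_basis = one0 | u2 | x3 | y3 | z3 | v4 | w6

fun M_deg :: "M_basis \<Rightarrow> nat" where
  "M_deg one0 = 0"
| "M_deg u2 = 2"
| "M_deg x3 = 3"
| "M_deg y3 = 3"
| "M_deg z3 = 3"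
| "M_deg v4 = 4"
| "M_deg w6 = 6"

definition M_bd :: "M_basis \<Rightarrow> M_basis vec2" where
  "M_bd b = (if b = v4 then gen x3 + gen y3 else 0)"

definition M_redcoprod :: "M_basis \<Rightarrow> (M_basis \<times> M_basis) vec2" where
  "M_redcoprod b =
     (if b = v4 then gen u2 \<otimes>\<^sub>2 gen u2
      else if b = w6 then gen x3 \<otimes>\<^sub>2 gen z3 + gen z3 \<otimes>\<^sub>2 gen y3
      else 0)"

definition M_coprod :: "M_basis \<Rightarrow> (M_basis \<times> M_basis) vec2" where
  "M_coprod b =
     (if b = one0 then gen one0 \<otimes>\<^sub>2 gen one0
      else gen b \<otimes>\<^sub>2 gen one0 + gen one0 \<otimes>\<^sub>2 gen b + M_redcoprod b)"

text \<open>The counit is forced by the coproduct.\<close>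

definition coalg_M :: "M_basis coalg" where
  "coalg_M = \<lparr> basis = UNIV, deg = M_deg, bd = M_bd, coprod = M_coprod,
               counit = (\<lambda>b. if b = one0 then 1 else 0) \<rparr>"

lemma lin_0 [simp]: "lin f 0 = 0"
  by (simp add: lin_def)

lemma lin_gen [simp]: "lin f (gen b) = f b"
  by (simp add: lin_def gen_def)

lemma vec2_add_self [simp]: "v + v = 0" for v :: "'b vec2"
  by (rule poly_mapping_eqI) (simp add: lookup_add)

lemma vec2_add_self_left [simp]: "v + (v + w) = w" for v w :: "'b vec2"
  by (simp flip: add.assoc)

lemma lin_add_self_cancel:
  fixes f :: "'a \<Rightarrow> 'v::comm_monoid_add"
  assumes "\<And>b. f b + f b = 0"
  shows "lin f (c + d) = lin f c + lin f d"
proof -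
  have l: "lin f c = (\<Sum>b\<in>S. if Poly_Mapping.lookup c b = 1 then f b else 0)"
    if "finite S" "Poly_Mapping.keys c \<subseteq> S" for c :: "'a vec2" and S
    unfolding lin_def using that
    by (intro sum.mono_neutral_cong_left) (auto simp: in_keys_iff)
  let ?S = "Poly_Mapping.keys c \<union> Poly_Mapping.keys d"
  have "Poly_Mapping.keys (c + d) \<subseteq> ?S"
    by (rule Poly_Mapping.keys_add)
  then show ?thesis
    by (simp add: l[where S = ?S] sum.distrib[symmetric] lookup_add)
       (rule sum.cong, auto simp: assms)
qed

lemma lin_add [simp]: "lin f (c + d) = lin f c + lin f d" for f :: "'a \<Rightarrow> 'b vec2"
  by (rule lin_add_self_cancel) simp

lemma lin_add_bit [simp]: "lin f (c + d) = lin f c + lin f d" for f :: "'a \<Rightarrow> bit"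
  by (rule lin_add_self_cancel) simp

lemma lin_zero_fun [simp]: "lin (\<lambda>_. 0) c = 0"
  by (simp add: lin_def)

lemma lin_add_fun: "lin (\<lambda>a. f a + g a) c = lin f c + lin g c"
  by (simp add: lin_def sum.distrib)

lemma tens_simps [simp]:
  "gen a \<otimes>\<^sub>2 gen b = gen (a, b)"
  "0 \<otimes>\<^sub>2 v = 0"
  "u \<otimes>\<^sub>2 0 = 0"
  "(u + u') \<otimes>\<^sub>2 v = u \<otimes>\<^sub>2 v + u' \<otimes>\<^sub>2 v"
  "u \<otimes>\<^sub>2 (v + v') = u \<otimes>\<^sub>2 v + u \<otimes>\<^sub>2 v'"
  by (simp_all add: tens_def lin_add_fun)

lemma keys_gen [simp]: "Poly_Mapping.keys (gen b) = {b}"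
  by (simp add: gen_def)

lemma chain_coalgebra_M: "chain_coalgebra coalg_M"
proof -
  note defs = coalg_M_def M_bd_def M_coprod_def M_redcoprod_def
  have keys: "coprod coalg_M b \<in> tensor_chains coalg_M (deg coalg_M b)" for b
    by (cases b) (auto simp: defs tensor_chains_def dest!: subsetD[OF Poly_Mapping.keys_add])
  have bd: "bd coalg_M b \<in> chains coalg_M n" if "deg coalg_M b = Suc n" for b n
    using that by (cases b) (auto simp: defs chains_def dest!: subsetD[OF Poly_Mapping.keys_add])
  show ?thesis
    unfolding chain_coalgebra_def
  proof (intro ballI conjI allI impI)
    fix b
    show "lin (coprod coalg_M) (bd coalg_M b) =
        tens_map (bd coalg_M) gen (coprod coalg_M b) + tens_map gen (bd coalg_M) (coprod coalg_M b)"
      by (cases b) (simp_all add: defs tens_map_def ac_simps)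
    show "assoc_map (tens_map (coprod coalg_M) gen (coprod coalg_M b)) =
        tens_map gen (coprod coalg_M) (coprod coalg_M b)"
      by (cases b) (simp_all add: defs tens_map_def assoc_map_def ac_simps)
    show "lin (\<lambda>(x, y). if counit coalg_M x = 1 then gen y else 0) (coprod coalg_M b) = gen b"
      by (cases b) (simp_all add: defs)
    show "lin (\<lambda>(x, y). if counit coalg_M y = 1 then gen x else 0) (coprod coalg_M b) = gen b"
      by (cases b) (simp_all add: defs)
    show "bd coalg_M b = 0" if "deg coalg_M b = 0"
      using that by (cases b) (simp_all add: defs)
    show "counit coalg_M b = 0" if "deg coalg_M b \<noteq> 0"
      using that by (cases b) (simp_all add: defs)
    show "lin (bd coalg_M) (bd coalg_M b) = 0"
      by (cases b) (simp_all add: defs)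
    show "lin (counit coalg_M) (bd coalg_M b) = 0"
      by (cases b) (simp_all add: defs)
  qed (use keys bd in auto)
qed

end

theory Submission
  imports Defs "HOL-Library.Function_Algebras"
begin

text \<open>
  Dualise. Let \<open>U\<close>, \<open>Z\<close> be cocycles in a differential algebra over \<open>F\<^sub>2\<close>, and let \<open>X\<close>, \<open>S\<close> satisfy
  \<open>d X = U U\<close> and \<open>d S = U Z + Z U\<close>. Then \<open>X Z + Z X + U S + S U\<close> is a cocycle, a sum of the
  triple Massey products of \<open>U, U, Z\<close> in their three orders. Whether some such cocycle is
  not a coboundary is invariant under quasi-isomorphisms.

  In the dual of \<open>M\<close> the elements dual to \<open>u\<close>, \<open>z\<close>, \<open>x\<close> together with \<open>S = 0\<close> yield the element dual
  to \<open>w\<close>, which is not a coboundary. In the normalized cochains of a space, the cup-1 product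
  with its coboundary formula and the Hirsch formula \<open>(a b) \<union>\<^sub>1 c = a (b \<union>\<^sub>1 c) + (a \<union>\<^sub>1 c) b\<close> shows that
  the cocycle is the coboundary of \<open>X \<union>\<^sub>1 Z + U \<union>\<^sub>1 S + U \<union>\<^sub>1 (U \<union>\<^sub>1 Z)\<close>.
\<close>

section \<open>An obstruction in differential algebras of characteristic two\<close>

text \<open>As simp rules these turn sums and products of bits into bit operations, out of reach of
  the ring laws used below.\<close>

declare add_bit_eq_xor [simp del] mult_bit_eq_and [simp del]

lemma bit_add_self [simp]: "a + a = 0" for a :: bit
  by (cases a) (auto simp: add_bit_eq_xor)

lemma bit_add_self_left [simp]: "a + (a + b) = b" for a b :: bit
  by (simp flip: add.assoc)

text \<open>The grading is forgotten, so elements may be inhomogeneous, and characteristic two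
  removes all signs. The additive and bilinear laws range over the whole type, which will be a
  function type with pointwise addition.\<close>

locale dg_algebra2 =
  fixes A :: "'r::ab_group_add set"
    and mult :: "'r \<Rightarrow> 'r \<Rightarrow> 'r" (infixl \<open>\<cdot>\<close> 70)
    and d :: "'r \<Rightarrow> 'r"
  assumes char2 [simp]: "x + x = 0"
    and zero_closed [simp]: "0 \<in> A"
    and add_closed [simp]: "x \<in> A \<Longrightarrow> y \<in> A \<Longrightarrow> x + y \<in> A"
    and mult_closed [simp]: "x \<in> A \<Longrightarrow> y \<in> A \<Longrightarrow> x \<cdot> y \<in> A"
    and d_closed [simp]: "x \<in> A \<Longrightarrow> d x \<in> A"
    and distrib_left: "x \<cdot> (y + z) = x \<cdot> y + x \<cdot> z"
    and distrib_right: "(x + y) \<cdot> z = x \<cdot> z + y \<cdot> z"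
    and mult_assoc: "x \<in> A \<Longrightarrow> y \<in> A \<Longrightarrow> z \<in> A \<Longrightarrow> x \<cdot> y \<cdot> z = x \<cdot> (y \<cdot> z)"
    and d_add: "d (x + y) = d x + d y"
    and d_d: "x \<in> A \<Longrightarrow> d (d x) = 0"
    and leibniz: "x \<in> A \<Longrightarrow> y \<in> A \<Longrightarrow> d (x \<cdot> y) = d x \<cdot> y + x \<cdot> d y"
begin

lemma char2_left [simp]: "x + (x + y) = y" for x y :: 'r
  using char2[of x] by (simp only: add_0_left flip: add.assoc)

lemma mult_zero [simp]: "0 \<cdot> x = 0" "x \<cdot> 0 = 0"
  using distrib_left[of x 0 0] distrib_right[of 0 0 x] by simp_all

lemma d_zero [simp]: "d 0 = 0"
  using d_add[of 0 0] by simp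

definition obstruction_system :: "'r \<Rightarrow> 'r \<Rightarrow> 'r \<Rightarrow> 'r \<Rightarrow> bool" where
  "obstruction_system U Z X S \<longleftrightarrow>
     U \<in> A \<and> Z \<in> A \<and> X \<in> A \<and> S \<in> A \<and>
     d U = 0 \<and> d Z = 0 \<and> d X = U \<cdot> U \<and> d S = U \<cdot> Z + Z \<cdot> U"

definition obstruction :: "'r \<Rightarrow> 'r \<Rightarrow> 'r \<Rightarrow> 'r \<Rightarrow> 'r" where
  "obstruction U Z X S = X \<cdot> Z + Z \<cdot> X + U \<cdot> S + S \<cdot> U"

definition obstructed :: bool where
  "obstructed \<longleftrightarrow> (\<exists>U Z X S. obstruction_system U Z X S \<and> obstruction U Z X S \<notin> d ` A)"

lemma d_image_add: "x \<in> d ` A \<Longrightarrow> y \<in> d ` A \<Longrightarrow> x + y \<in> d ` A"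
  by (auto simp flip: d_add)

text \<open>Each of \<open>U U Z\<close>, \<open>U Z U\<close> and \<open>Z U U\<close> occurs
  exactly twice in the differential.\<close>

lemma d_obstruction: "obstruction_system U Z X S \<Longrightarrow> d (obstruction U Z X S) = 0"
  unfolding obstruction_system_def obstruction_def
  by (simp add: d_add leibniz distrib_left distrib_right mult_assoc ac_simps)

lemmas d_expand = d_add leibniz distrib_left distrib_right mult_assoc d_d

text \<open>The corrections in \<open>X'\<close> and \<open>S'\<close> are primitives of the changes
  of \<open>U U\<close> and of \<open>U Z + Z U\<close> when \<open>U\<close> moves within its
  cohomology class.\<close>

lemma change_first:
  assumes "obstruction_system U Z X S" "a \<in> A"
  defines "X' \<equiv> X + a \<cdot> U + U \<cdot> a + a \<cdot> d a"
    and "S' \<equiv> S + a \<cdot> Z + Z \<cdot> a"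
  shows "obstruction_system (U + d a) Z X' S'"
    and "obstruction (U + d a) Z X' S' = obstruction U Z X S
           + d (a \<cdot> S + S \<cdot> a + a \<cdot> (a \<cdot> Z) + a \<cdot> (Z \<cdot> a))"
  using assms(1,2) unfolding obstruction_system_def obstruction_def X'_def S'_def
  by (simp_all add: d_expand ac_simps)

text \<open>Among the new terms \<open>U b U\<close> cancels, and \<open>U U b + b U U\<close>
  together with \<open>X (d b) + (d b) X\<close> is exact because \<open>d X = U U\<close>.\<close>

lemma change_second:
  assumes "obstruction_system U Z X S" "b \<in> A"
  defines "S' \<equiv> S + U \<cdot> b + b \<cdot> U"
  shows "obstruction_system U (Z + d b) X S'"
    and "obstruction U (Z + d b) X S' = obstruction U Z X S + d (X \<cdot> b + b \<cdot> X)"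
  using assms(1,2) unfolding obstruction_system_def obstruction_def S'_def
  by (simp_all add: d_expand ac_simps)

text \<open>Covers the exact error terms with which \<open>lift\<close> below meets prescribed
  primitives.\<close>

lemma change_rest:
  assumes "obstruction_system U Z X S" "g \<in> A" "e \<in> A"
  shows "obstruction_system U Z (X + d g) (S + d e)"
    and "obstruction U Z (X + d g) (S + d e) = obstruction U Z X S
           + d (g \<cdot> Z + Z \<cdot> g + U \<cdot> e + e \<cdot> U)"
  using assms unfolding obstruction_system_def obstruction_def
  by (simp_all add: d_expand ac_simps)

end

section \<open>Invariance of the obstruction under quasi-isomorphisms of algebras\<close>

locale dg_quasi_iso2 = A: dg_algebra2 A mA dA + B: dg_algebra2 B mB dB
  for A :: "'r::ab_group_add set" and mA :: "'r \<Rightarrow> 'r \<Rightarrow> 'r" (infixl \<open>\<cdot>\<close> 70) and dA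
    and B :: "'s::ab_group_add set" and mB :: "'s \<Rightarrow> 's \<Rightarrow> 's" (infixl \<open>\<star>\<close> 70) and dB +
  fixes f :: "'r \<Rightarrow> 's"
  assumes f_closed [simp]: "x \<in> A \<Longrightarrow> f x \<in> B"
    and f_add: "f (x + y) = f x + f y"
    and f_mult: "x \<in> A \<Longrightarrow> y \<in> A \<Longrightarrow> f (x \<cdot> y) = f x \<star> f y"
    and f_d: "x \<in> A \<Longrightarrow> f (dA x) = dB (f x)"
    and f_inj: "x \<in> A \<Longrightarrow> dA x = 0 \<Longrightarrow> f x \<in> dB ` B \<Longrightarrow> x \<in> dA ` A"
    and f_surj: "b \<in> B \<Longrightarrow> dB b = 0 \<Longrightarrow> \<exists>x\<in>A. dA x = 0 \<and> f x + b \<in> dB ` B"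
begin

lemma f_zero [simp]: "f 0 = 0"
  using f_add[of 0 0] by simp

lemma f_obstruction_system:
  "A.obstruction_system U Z X S \<Longrightarrow> B.obstruction_system (f U) (f Z) (f X) (f S)"
  unfolding A.obstruction_system_def B.obstruction_system_def
  by (metis f_add f_closed f_d f_mult f_zero)

lemma f_obstruction:
  "A.obstruction_system U Z X S \<Longrightarrow>
     f (A.obstruction U Z X S) = B.obstruction (f U) (f Z) (f X) (f S)"
  unfolding A.obstruction_system_def A.obstruction_def B.obstruction_def
  by (simp add: f_add f_mult)

text \<open>Injectivity on cohomology supplies some primitive of \<open>w\<close>. Its image differs
  from \<open>y\<close> by a cocycle, which by surjectivity is the image of a cocycle of
  \<open>A\<close> up to an exact term. With \<open>w = 0\<close> this lifts cohomology
  classes.\<close>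

lemma lift:
  assumes "w \<in> A" "dA w = 0" "y \<in> B" "f w = dB y"
  obtains x e where "x \<in> A" "dA x = w" "e \<in> B" "f x = y + dB e"
proof -
  obtain x0 where x0: "x0 \<in> A" "dA x0 = w"
    using f_inj[of w] assms by auto
  have "dB (f x0 + y) = 0"
    using x0 assms by (simp add: B.d_add flip: f_d)
  then obtain x1 e where x1: "x1 \<in> A" "dA x1 = 0" "e \<in> B" "f x1 + (f x0 + y) = dB e"
    using f_surj[of "f x0 + y"] x0 assms by auto
  have "f (x0 + x1) = y + dB e"
    by (simp add: f_add ac_simps flip: x1(4))
  then show ?thesis
    using that[of "x0 + x1" e] x0 x1 by (simp add: A.d_add)
qed

lemma obstructed_iff: "A.obstructed \<longleftrightarrow> B.obstructed"
proof
  assume A.obstructed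
  then obtain U Z X S where sys: "A.obstruction_system U Z X S"
    and "A.obstruction U Z X S \<notin> dA ` A"
    unfolding A.obstructed_def by blast
  then have "f (A.obstruction U Z X S) \<notin> dB ` B"
    using f_inj[of "A.obstruction U Z X S"] A.d_obstruction[OF sys]
    by (auto simp: A.obstruction_system_def A.obstruction_def)
  then show B.obstructed
    unfolding B.obstructed_def f_obstruction[OF sys] using f_obstruction_system[OF sys] by blast
next
  assume B.obstructed
  then obtain U0 Z0 X0 S0 where sys0: "B.obstruction_system U0 Z0 X0 S0"
    and no: "B.obstruction U0 Z0 X0 S0 \<notin> dB ` B"
    unfolding B.obstructed_def by blast
  note mem0 = sys0[unfolded B.obstruction_system_def]
  \<comment> \<open>\<open>U\<close> and \<open>Z\<close> are lifted before \<open>X\<close> and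
    \<open>S\<close>, whose equations involve the lifted \<open>U\<close> and \<open>Z\<close>. The
    system in \<open>B\<close> follows through the change lemmas.\<close>
  obtain U a where U: "U \<in> A" "dA U = 0" "a \<in> B" "f U = U0 + dB a"
    by (rule lift[of 0 U0]) (use mem0 in auto)
  define X1 where "X1 = X0 + a \<star> U0 + U0 \<star> a + a \<star> dB a"
  define S1 where "S1 = S0 + a \<star> Z0 + Z0 \<star> a"
  define o1 where "o1 = a \<star> S0 + S0 \<star> a + a \<star> (a \<star> Z0) + a \<star> (Z0 \<star> a)"
  have sys1: "B.obstruction_system (f U) Z0 X1 S1"
    and eq1: "B.obstruction (f U) Z0 X1 S1 = B.obstruction U0 Z0 X0 S0 + dB o1"
    using B.change_first[OF sys0 U(3)] U(4) by (auto simp: X1_def S1_def o1_def)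
  obtain Z b where Z: "Z \<in> A" "dA Z = 0" "b \<in> B" "f Z = Z0 + dB b"
    by (rule lift[of 0 Z0]) (use mem0 in auto)
  define S2 where "S2 = S1 + f U \<star> b + b \<star> f U"
  have sys2: "B.obstruction_system (f U) (f Z) X1 S2"
    and eq2: "B.obstruction (f U) (f Z) X1 S2
                = B.obstruction (f U) Z0 X1 S1 + dB (X1 \<star> b + b \<star> X1)"
    using B.change_second[OF sys1 Z(3)] Z(4) by (auto simp: S2_def)
  note mem2 = sys2[unfolded B.obstruction_system_def]
  obtain X g where X: "X \<in> A" "dA X = U \<cdot> U" "g \<in> B" "f X = X1 + dB g"
    by (rule lift[of "U \<cdot> U" X1]) (use mem2 U in \<open>auto simp: A.leibniz f_mult\<close>)
  obtain S e where S: "S \<in> A" "dA S = U \<cdot> Z + Z \<cdot> U" "e \<in> B" "f S = S2 + dB e"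
    by (rule lift[of "U \<cdot> Z + Z \<cdot> U" S2])
       (use mem2 U Z in \<open>auto simp: A.leibniz A.d_add f_mult f_add\<close>)
  define o3 where "o3 = g \<star> f Z + f Z \<star> g + f U \<star> e + e \<star> f U"
  have eq3: "B.obstruction (f U) (f Z) (f X) (f S)
              = B.obstruction (f U) (f Z) X1 S2 + dB o3"
    using B.change_rest[OF sys2 X(3) S(3)] X(4) S(4) by (auto simp: o3_def)
  have sys: "A.obstruction_system U Z X S"
    unfolding A.obstruction_system_def using U Z X S by auto
  have mem: "o1 \<in> B" "X1 \<star> b + b \<star> X1 \<in> B" "o3 \<in> B"
    using mem0 mem2 U(1,3) Z(1,3) X(3) S(3) by (auto simp: o1_def o3_def)
  have "A.obstruction U Z X S \<notin> dA ` A"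
  proof
    assume "A.obstruction U Z X S \<in> dA ` A"
    then have "f (A.obstruction U Z X S) \<in> dB ` B"
      using f_d by auto
    \<comment> \<open>Adding the three recorded coboundaries again recovers the obstruction of the
      original system, since equal terms cancel.\<close>
    then have "B.obstruction (f U) (f Z) (f X) (f S) + dB o3 + dB (X1 \<star> b + b \<star> X1) + dB o1
                 \<in> dB ` B"
      unfolding f_obstruction[OF sys] using mem by (intro B.d_image_add imageI)
    then show False
      using no unfolding eq3 eq2 eq1 by (simp add: ac_simps)
  qed
  then show A.obstructed
    unfolding A.obstructed_def using sys by blast
qed

end

section \<open>Cup products of functions on vertex lists\<close>

text \<open>
  A function on vertex lists is treated as a cochain on the full simplex spanned by the vertices.
  With \<open>F\<^sub>v us = F (v # us)\<close>, the recursive equations below are the usual sums over positions of a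
  list, split according to whether the first vertex is involved: \<open>lcup1 F G\<close> is Steenrod's sum of
  \<open>F (v\<^sub>0 \<dots> v\<^sub>i v\<^sub>j \<dots> v\<^sub>n) G (v\<^sub>i \<dots> v\<^sub>j)\<close> over \<open>i < j\<close>, and its terms with \<open>i = 0\<close> form a cup product of \<open>G\<^sub>v\<close> and
  \<open>F\<^sub>v\<close>. The value at the empty list is arbitrary.
\<close>

type_synonym 'v lcochain = "'v list \<Rightarrow> bit"

fun lcobd :: "'v lcochain \<Rightarrow> 'v lcochain" where
  "lcobd F [] = 0"
| "lcobd F (v # vs) = F vs + lcobd (\<lambda>us. F (v # us)) vs"

fun lcup :: "'v lcochain \<Rightarrow> 'v lcochain \<Rightarrow> 'v lcochain" where
  "lcup F G [] = 0"
| "lcup F G (v # vs) = F [v] * G (v # vs) + lcup (\<lambda>us. F (v # us)) G vs"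

fun lcup1 :: "'v lcochain \<Rightarrow> 'v lcochain \<Rightarrow> 'v lcochain" where
  "lcup1 F G [] = 0"
| "lcup1 F G (v # vs) =
     lcup (\<lambda>us. G (v # us)) (\<lambda>us. F (v # us)) vs + lcup1 (\<lambda>us. F (v # us)) G vs"

lemma lcobd_0 [simp]: "lcobd (\<lambda>_. 0) vs = 0"
  by (induction vs) auto

lemma lcup_0 [simp]: "lcup (\<lambda>_. 0) G vs = 0" "lcup F (\<lambda>_. 0) vs = 0"
  by (induction vs arbitrary: F) auto

lemma lcup1_0 [simp]: "lcup1 (\<lambda>_. 0) G vs = 0" "lcup1 F (\<lambda>_. 0) vs = 0"
  by (induction vs arbitrary: F) auto

lemma lcobd_add: "lcobd (\<lambda>us. F us + G us) vs = lcobd F vs + lcobd G vs"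
  by (induction vs arbitrary: F G) (simp_all add: ac_simps)

lemma lcobd_scale: "lcobd (\<lambda>us. a * F us) vs = a * lcobd F vs"
  by (induction vs arbitrary: F) (simp_all add: algebra_simps)

lemma lcup_add_left: "lcup (\<lambda>us. F us + F' us) G vs = lcup F G vs + lcup F' G vs"
  by (induction vs arbitrary: F F') (simp_all add: algebra_simps)

lemma lcup_add_right: "lcup F (\<lambda>us. G us + G' us) vs = lcup F G vs + lcup F G' vs"
  by (induction vs arbitrary: F) (simp_all add: algebra_simps)

lemma lcup_scale_left: "lcup (\<lambda>us. a * F us) G vs = a * lcup F G vs"
  by (induction vs arbitrary: F) (simp_all add: algebra_simps)

lemma lcup_scale_right: "lcup F (\<lambda>us. a * G us) vs = a * lcup F G vs"
  by (induction vs arbitrary: F) (simp_all add: algebra_simps)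

lemma lcup1_add_left: "lcup1 (\<lambda>us. F us + F' us) G vs = lcup1 F G vs + lcup1 F' G vs"
  by (induction vs arbitrary: F F') (simp_all add: algebra_simps lcup_add_right)

lemma lcup1_add_right: "lcup1 F (\<lambda>us. G us + G' us) vs = lcup1 F G vs + lcup1 F G' vs"
  by (induction vs arbitrary: F) (simp_all add: algebra_simps lcup_add_left)

lemma lcup1_scale_left: "lcup1 (\<lambda>us. a * F us) G vs = a * lcup1 F G vs"
  by (induction vs arbitrary: F) (simp_all add: algebra_simps lcup_scale_right)

lemmas llinear = lcobd_add lcobd_scale lcup_add_left lcup_add_right lcup_scale_left lcup_scale_right
  lcup1_add_left lcup1_add_right lcup1_scale_left

lemma lcobd_lcobd: "lcobd (lcobd F) vs = 0"
  by (induction vs arbitrary: F) (simp_all add: llinear)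

lemma lcup_assoc: "lcup (lcup F G) H vs = lcup F (lcup G H) vs"
  by (induction vs arbitrary: F G) (simp_all add: llinear algebra_simps)

text \<open>The last two terms compensate for deleting the only vertex of a one-vertex front or back
  face on the right-hand side. They cannot be dropped by assuming value 0 at \<open>[]\<close>: the
  induction passes to \<open>F\<^sub>v\<close>, whose value there is \<open>F [v]\<close>.\<close>

lemma lcobd_lcup:
  "lcobd (lcup F G) vs = lcup (lcobd F) G vs + lcup F (lcobd G) vs + F [] * G vs + F vs * G []"
proof (induction vs arbitrary: F G)
  case (Cons v vs)
  then show ?case
    by (simp add: llinear algebra_simps)
qed simp

text \<open>Steenrod's coboundary formula. In the induction, the extra terms of
  \<open>lcobd_lcup\<close> for \<open>G\<^sub>v\<close> and \<open>F\<^sub>v\<close> are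
  \<open>G [v] * F (v # vs)\<close> and \<open>G (v # vs) * F [v]\<close>, the first terms of the
  two cup products.\<close>

lemma lcobd_lcup1:
  "lcobd (lcup1 F G) vs =
     lcup1 (lcobd F) G vs + lcup1 F (lcobd G) vs + lcup F G vs + lcup G F vs"
proof (induction vs arbitrary: F G)
  case (Cons v vs)
  then show ?case
    by (simp add: llinear lcobd_lcup algebra_simps)
qed simp

text \<open>The Hirsch formula. The vertex at which the product is cut lies at or before
  \<open>v\<^sub>i\<close>, or at or after \<open>v\<^sub>j\<close>; accordingly the face
  \<open>v\<^sub>i \<dots> v\<^sub>j\<close> is spliced into the argument of \<open>G\<close> or of
  \<open>F\<close>.\<close>

lemma lcup1_lcup:
  "lcup1 (lcup F G) H vs = lcup F (lcup1 G H) vs + lcup (lcup1 F H) G vs"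
proof (induction vs arbitrary: F G H)
  case (Cons v vs)
  show ?case
    by (simp add: llinear Cons lcup_assoc algebra_simps)
qed simp

lemma lcobd_map: "lcobd F (map g vs) = lcobd (\<lambda>us. F (map g us)) vs"
  by (induction vs arbitrary: F) simp_all

lemma lcup_map: "lcup F G (map g vs) = lcup (\<lambda>us. F (map g us)) (\<lambda>us. G (map g us)) vs"
  by (induction vs arbitrary: F) simp_all

lemma lcup1_map: "lcup1 F G (map g vs) = lcup1 (\<lambda>us. F (map g us)) (\<lambda>us. G (map g us)) vs"
  by (induction vs arbitrary: F) (simp_all add: lcup_map)

section \<open>Normalized list cochains, vanishing on lists with equal neighbours\<close>

definition lnormalized :: "'v lcochain \<Rightarrow> bool" where
  "lnormalized F \<longleftrightarrow> (\<forall>us v vs. F (us @ v # v # vs) = 0)"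

lemma lnormalizedD [simp]:
  "lnormalized F \<Longrightarrow> F (v # v # vs) = 0" "lnormalized F \<Longrightarrow> F (us @ v # v # vs) = 0"
   "lnormalized F \<Longrightarrow> F (u # us @ v # v # vs) = 0"
  unfolding lnormalized_def by (metis append_Nil, blast, metis append_Cons)

lemma lnormalized_Cons [intro, simp]: "lnormalized F \<Longrightarrow> lnormalized (\<lambda>us. F (v # us))"
  unfolding lnormalized_def by (metis append_Cons)

text \<open>Deleting either of the equal neighbours leaves the same list, so these two terms cancel;
  all others still contain both.\<close>

lemma lnormalized_lcobd [intro]: "lnormalized F \<Longrightarrow> lnormalized (lcobd F)"
  unfolding lnormalized_def[of "lcobd F"]
proof (intro allI)
  fix us vs :: "'a list" and v
  show "lnormalized F \<Longrightarrow> lcobd F (us @ v # v # vs) = 0"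
    by (induction us arbitrary: F) simp_all
qed

text \<open>Front and back face share a vertex, so in every term one of them contains both equal
  neighbours.\<close>

lemma lnormalized_lcup [intro]: "lnormalized F \<Longrightarrow> lnormalized G \<Longrightarrow> lnormalized (lcup F G)"
  unfolding lnormalized_def[of "lcup F G"]
proof (intro allI)
  fix us vs :: "'a list" and v
  show "lnormalized F \<Longrightarrow> lnormalized G \<Longrightarrow> lcup F G (us @ v # v # vs) = 0"
    by (induction us arbitrary: F) simp_all
qed

lemma lnormalized_lcup1 [intro]: "lnormalized F \<Longrightarrow> lnormalized G \<Longrightarrow> lnormalized (lcup1 F G)"
  unfolding lnormalized_def[of "lcup1 F G"]
proof (intro allI)
  fix us vs :: "'a list" and v
  assume G: "lnormalized G"
  show "lnormalized F \<Longrightarrow> lcup1 F G (us @ v # v # vs) = 0"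
    by (induction us arbitrary: F)
       (use G in \<open>simp_all add: lnormalizedD(2)[OF lnormalized_lcup]\<close>)
qed

text \<open>By the Hirsch formula \<open>lcup1 (lcup U U) Z\<close> is \<open>U P + P U\<close> with
  \<open>P = lcup1 U Z\<close>. The coboundary of \<open>lcup1 U P\<close> contributes the same two
  terms, and it also cancels \<open>lcup1 U (lcobd S)\<close> because \<open>P\<close> and
  \<open>S\<close> have the same coboundary.\<close>

lemma lobstruction:
  assumes "lcobd U = (\<lambda>_. 0)" "lcobd Z = (\<lambda>_. 0)" "lcobd X = lcup U U"
    and "lcobd S = (\<lambda>vs. lcup U Z vs + lcup Z U vs)"
  shows "lcobd (\<lambda>vs. lcup1 X Z vs + lcup1 U S vs + lcup1 U (lcup1 U Z) vs) vs =
     lcup X Z vs + lcup Z X vs + lcup U S vs + lcup S U vs"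
proof -
  have "lcobd (lcup1 U Z) = (\<lambda>vs. lcup U Z vs + lcup Z U vs)"
    by (rule ext) (simp add: assms lcobd_lcup1)
  then show ?thesis
    using assms by (simp add: llinear lcobd_lcup1 lcup1_lcup ac_simps)
qed

section \<open>Linear algebra over the field with two elements\<close>

lemma lin_cong: "(\<And>b. b \<in> Poly_Mapping.keys c \<Longrightarrow> f b = g b) \<Longrightarrow> lin f c = lin g c"
  by (simp add: lin_def)

lemma vec2_eq_sum_gen: "c = (\<Sum>b\<in>Poly_Mapping.keys c. gen b)" for c :: "'b vec2"
proof (rule poly_mapping_eqI)
  fix b
  have "Poly_Mapping.lookup c b = (if b \<in> Poly_Mapping.keys c then 1 else 0)"
    by (simp add: in_keys_iff)
  then show "Poly_Mapping.lookup c b = Poly_Mapping.lookup (\<Sum>b\<in>Poly_Mapping.keys c. gen b) b"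
    by (simp add: lookup_sum gen_def lookup_single when_def)
qed

lemma additive_sum:
  fixes g :: "'a::comm_monoid_add \<Rightarrow> 'b::comm_monoid_add"
  assumes "g 0 = 0" "\<And>x y. g (x + y) = g x + g y"
  shows "g (\<Sum>i\<in>I. h i) = (\<Sum>i\<in>I. g (h i))"
  by (induction I rule: infinite_finite_induct) (simp_all add: assms)

lemma additive_lin:
  fixes g :: "'a::comm_monoid_add \<Rightarrow> 'b::comm_monoid_add"
  assumes "g 0 = 0" "\<And>x y. g (x + y) = g x + g y"
  shows "g (lin h c) = lin (\<lambda>b. g (h b)) c"
  unfolding lin_def by (rule additive_sum[OF assms])

lemma additive_eq_lin:
  fixes g :: "'b vec2 \<Rightarrow> 'v::comm_monoid_add"
  assumes "g 0 = 0" "\<And>x y. g (x + y) = g x + g y"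
  shows "g c = lin (\<lambda>b. g (gen b)) c"
  unfolding lin_def by (subst vec2_eq_sum_gen) (rule additive_sum[OF assms])

lemma lin_lin: "lin g (lin f c) = lin (\<lambda>b. lin g (f b)) c" for g :: "'a \<Rightarrow> 'b vec2"
  by (rule additive_lin) simp_all

lemma lin_lin_bit: "lin g (lin f c) = lin (\<lambda>b. lin g (f b)) c" for g :: "'a \<Rightarrow> bit"
  by (rule additive_lin) simp_all

lemma lin_scale_bit: "lin (\<lambda>b. a * g b) c = a * lin g c" for g :: "'a \<Rightarrow> bit"
  by (simp add: lin_def sum_distrib_left)

lemma lin_scale_bit_right: "lin (\<lambda>b. g b * a) c = lin g c * a" for g :: "'a \<Rightarrow> bit"
  by (simp add: lin_def sum_distrib_right)

lemma lin_tens: "lin (\<lambda>(a, b). f a * g b) (u \<otimes>\<^sub>2 v) = lin f u * lin g v" for f :: "'a \<Rightarrow> bit"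
  by (simp add: tens_def lin_lin_bit lin_scale_bit lin_scale_bit_right)

lemma lin_tens_map:
  "lin (\<lambda>(a, b). f a * g b) (tens_map p q c) = lin (\<lambda>(a, b). lin f (p a) * lin g (q b)) c"
  for f :: "'a \<Rightarrow> bit"
  unfolding tens_map_def lin_lin_bit by (rule lin_cong) (auto simp: lin_tens)

text \<open>Gives access to bases, spans and the extension of linear maps, with scalar
  multiplication by a bit written as a conditional.\<close>

global_interpretation vec2: vector_space "\<lambda>(a::bit) (v::'b vec2). if a = 1 then v else 0"
  by standard (auto simp: add_bit_eq_xor mult_bit_eq_and)

text \<open>\<open>R\<close> is the graph of a linear functional on a subspace.\<close>

lemma linear_graph_extends:
  fixes R :: "('b vec2 \<times> bit) set"
  assumes add: "\<And>x a y b. (x, a) \<in> R \<Longrightarrow> (y, b) \<in> R \<Longrightarrow> (x + y, a + b) \<in> R"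
    and zero: "(0, 0) \<in> R" and single: "(0, 1) \<notin> R"
  obtains \<beta> :: "'b \<Rightarrow> bit" where "\<And>x a. (x, a) \<in> R \<Longrightarrow> lin \<beta> x = a"
proof -
  interpret vector_space_pair "\<lambda>(a::bit) (v::'b vec2). if a = 1 then v else 0" "(*) :: bit \<Rightarrow> bit \<Rightarrow> bit"
    by standard (auto simp: distrib_left distrib_right mult.assoc)
  have unique: "a = b" if "(x, a) \<in> R" "(x, b) \<in> R" for x a b
    using add[OF that] single by (cases a; cases b) auto
  obtain B where B: "B \<subseteq> Domain R" "vec2.independent B" "Domain R \<subseteq> vec2.span B"
    using vec2.maximal_independent_subset by blast
  obtain g where g: "Vector_Spaces.linear (\<lambda>(a::bit) (v::'b vec2). if a = 1 then v else 0) (*) g"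
    "\<And>x. x \<in> B \<Longrightarrow> g x = (THE a. (x, a) \<in> R)"
    using linear_independent_extend[OF B(2), of "\<lambda>x. THE a. (x, a) \<in> R"] by blast
  interpret g: Vector_Spaces.linear "\<lambda>(a::bit) (v::'b vec2). if a = 1 then v else 0" "(*)" g
    by (fact g(1))
  \<comment> \<open>The vectors over which the graph of \<open>g\<close> lies in \<open>R\<close>
    form a subspace containing \<open>B\<close>, hence containing the domain of
    \<open>R\<close>.\<close>
  have "vec2.span B \<subseteq> {x. (x, g x) \<in> R}"
  proof (rule vec2.span_minimal)
    show "B \<subseteq> {x. (x, g x) \<in> R}"
    proof
      fix x assume x: "x \<in> B"
      then obtain a where a: "(x, a) \<in> R" using B(1) by blast
      then have "(THE a. (x, a) \<in> R) = a" by (rule the_equality) (rule unique[OF _ a])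
      with a show "x \<in> {x. (x, g x) \<in> R}" using g(2)[OF x] by simp
    qed
    show "vec2.subspace {x. (x, g x) \<in> R}"
      by (rule vec2.subspaceI) (auto simp: zero g.zero g.add add)
  qed
  then have graph: "(x, g x) \<in> R" if "(x, a) \<in> R" for x a
    using that B(3) by (blast dest: DomainI)
  show ?thesis
  proof (rule that)
    fix x a assume "(x, a) \<in> R"
    then show "lin (\<lambda>b. g (gen b)) x = a"
      using unique[OF graph] additive_eq_lin[of g x, OF g.zero g.add] by simp
  qed
qed

section \<open>Dual algebras\<close>

text \<open>The dual of the total space, without a splitting by degree. Vanishing off the basis
  makes equality of cochains equality of functions.\<close>

definition cochains :: "'b coalg \<Rightarrow> ('b \<Rightarrow> bit) set" where
  "cochains C = {\<phi>. \<forall>b. b \<notin> basis C \<longrightarrow> \<phi> b = 0}"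

definition coboundary :: "'b coalg \<Rightarrow> ('b \<Rightarrow> bit) \<Rightarrow> 'b \<Rightarrow> bit" where
  "coboundary C \<phi> b = (if b \<in> basis C then lin \<phi> (bd C b) else 0)"

definition cup :: "'b coalg \<Rightarrow> ('b \<Rightarrow> bit) \<Rightarrow> ('b \<Rightarrow> bit) \<Rightarrow> 'b \<Rightarrow> bit" where
  "cup C \<phi> \<psi> b = (if b \<in> basis C then lin (\<lambda>(x, y). \<phi> x * \<psi> y) (coprod C b) else 0)"

definition pullback :: "'a coalg \<Rightarrow> ('a \<Rightarrow> 'b vec2) \<Rightarrow> ('b \<Rightarrow> bit) \<Rightarrow> 'a \<Rightarrow> bit" where
  "pullback C f \<phi> b = (if b \<in> basis C then lin \<phi> (f b) else 0)"

text \<open>A consequence of \<open>chain_coalgebra\<close> that suffices for dualising. For normalized chains it is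
  verified on cochains, without proving \<open>chain_coalgebra\<close>.\<close>

definition has_dual :: "'b coalg \<Rightarrow> bool" where
  "has_dual C \<longleftrightarrow>
     (\<forall>b\<in>basis C. (deg C b = 0 \<longrightarrow> bd C b = 0) \<and>
        (\<forall>n. deg C b = Suc n \<longrightarrow> bd C b \<in> chains C n) \<and>
        Poly_Mapping.keys (coprod C b) \<subseteq> basis C \<times> basis C) \<and>
     dg_algebra2 (cochains C) (cup C) (coboundary C)"

lemma lin_plus_fun: "lin (f + g) c = lin f c + lin g c"
  by (simp add: plus_fun_def lin_add_fun)

lemma fun_bit_add_self: "\<phi> + \<phi> = 0" for \<phi> :: "'b \<Rightarrow> bit"
proof
  fix b show "(\<phi> + \<phi>) b = 0 b" by (cases "\<phi> b") simp_all
qed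

lemma cup_add_left: "cup C (\<phi> + \<phi>') \<psi> = cup C \<phi> \<psi> + cup C \<phi>' \<psi>"
  unfolding cup_def fun_eq_iff plus_fun_apply
  by (simp add: distrib_right case_prod_unfold lin_add_fun)

lemma cup_add_right: "cup C \<phi> (\<psi> + \<psi>') = cup C \<phi> \<psi> + cup C \<phi> \<psi>'"
  unfolding cup_def fun_eq_iff plus_fun_apply
  by (simp add: distrib_left case_prod_unfold lin_add_fun)

lemma coboundary_add: "coboundary C (\<phi> + \<psi>) = coboundary C \<phi> + coboundary C \<psi>"
  by (auto simp: coboundary_def fun_eq_iff lin_plus_fun)

lemma has_dualI:
  assumes "\<And>b. b \<in> basis C \<Longrightarrow> deg C b = 0 \<Longrightarrow> bd C b = 0"
    and "\<And>b n. b \<in> basis C \<Longrightarrow> deg C b = Suc n \<Longrightarrow> bd C b \<in> chains C n"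
    and "\<And>b. b \<in> basis C \<Longrightarrow> Poly_Mapping.keys (coprod C b) \<subseteq> basis C \<times> basis C"
    and "\<And>\<phi> \<psi> \<theta>. \<phi> \<in> cochains C \<Longrightarrow> \<psi> \<in> cochains C \<Longrightarrow> \<theta> \<in> cochains C \<Longrightarrow>
           cup C (cup C \<phi> \<psi>) \<theta> = cup C \<phi> (cup C \<psi> \<theta>)"
    and "\<And>\<phi>. \<phi> \<in> cochains C \<Longrightarrow> coboundary C (coboundary C \<phi>) = 0"
    and "\<And>\<phi> \<psi>. \<phi> \<in> cochains C \<Longrightarrow> \<psi> \<in> cochains C \<Longrightarrow>
           coboundary C (cup C \<phi> \<psi>) = cup C (coboundary C \<phi>) \<psi> + cup C \<phi> (coboundary C \<psi>)"
  shows "has_dual C"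
  unfolding has_dual_def
proof (intro conjI ballI allI impI dg_algebra2.intro assms cup_add_left cup_add_right
    coboundary_add fun_bit_add_self)
qed (auto simp: cochains_def cup_def coboundary_def)

lemma keys_bd:
  assumes "\<forall>b\<in>basis C. (deg C b = 0 \<longrightarrow> bd C b = 0) \<and> (\<forall>n. deg C b = Suc n \<longrightarrow> bd C b \<in> chains C n)"
    and "b \<in> basis C"
  shows "Poly_Mapping.keys (bd C b) \<subseteq> basis C"
  using assms unfolding chains_def by (cases "deg C b") fastforce+

lemma has_dual_chain_coalgebra:
  assumes "chain_coalgebra C"
  shows "has_dual C"
proof (rule has_dualI)
  fix b assume b: "b \<in> basis C"
  note C = assms[unfolded chain_coalgebra_def, rule_format, OF b]
  show "bd C b = 0" if "deg C b = 0" using C that by blast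
  show "bd C b \<in> chains C n" if "deg C b = Suc n" for n using C that by blast
  show "Poly_Mapping.keys (coprod C b) \<subseteq> basis C \<times> basis C"
    using C unfolding tensor_chains_def by blast
next
  \<comment> \<open>\<open>cup\<close> and \<open>coboundary\<close> test for membership in the
    basis. These congruences remove the inner tests, as differential and coproduct are supported on
    the basis.\<close>
  have bd_cong: "lin f (bd C b) = lin g (bd C b)"
    if "b \<in> basis C" "\<And>x. x \<in> basis C \<Longrightarrow> f x = g x" for b and f g :: "'a \<Rightarrow> bit"
    using keys_bd[OF _ that(1)] assms that(2) unfolding chain_coalgebra_def
    by (intro lin_cong) blast
  have coprod_cong: "lin f (coprod C b) = lin g (coprod C b)"
    if "b \<in> basis C" "\<And>x y. x \<in> basis C \<Longrightarrow> y \<in> basis C \<Longrightarrow> f (x, y) = g (x, y)"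
    for b and f g :: "'a \<times> 'a \<Rightarrow> bit"
    using assms that unfolding chain_coalgebra_def tensor_chains_def
    by (intro lin_cong) blast
  fix \<phi> \<psi> \<theta>
  show "coboundary C (coboundary C \<phi>) = 0"
  proof
    fix b
    have "coboundary C (coboundary C \<phi>) b = lin \<phi> (lin (bd C) (bd C b))" if "b \<in> basis C"
      using that unfolding lin_lin_bit
      by (simp add: coboundary_def cong: bd_cong)
    then show "coboundary C (coboundary C \<phi>) b = 0 b"
      using assms by (cases "b \<in> basis C") (auto simp: chain_coalgebra_def coboundary_def)
  qed
  show "coboundary C (cup C \<phi> \<psi>) = cup C (coboundary C \<phi>) \<psi> + cup C \<phi> (coboundary C \<psi>)"
  proof
    fix b
    have "coboundary C (cup C \<phi> \<psi>) b =
        cup C (coboundary C \<phi>) \<psi> b + cup C \<phi> (coboundary C \<psi>) b" if b: "b \<in> basis C"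
    proof -
      have "coboundary C (cup C \<phi> \<psi>) b =
          lin (\<lambda>(x, y). \<phi> x * \<psi> y) (lin (coprod C) (bd C b))"
        using b unfolding lin_lin_bit by (simp add: coboundary_def cup_def cong: bd_cong)
      also have "\<dots> = lin (\<lambda>(x, y). \<phi> x * \<psi> y)
          (tens_map (bd C) gen (coprod C b) + tens_map gen (bd C) (coprod C b))"
        using assms b by (simp add: chain_coalgebra_def)
      also have "\<dots> = cup C (coboundary C \<phi>) \<psi> b + cup C \<phi> (coboundary C \<psi>) b"
        unfolding lin_add_bit lin_tens_map using b
        by (simp add: cup_def)
           (intro arg_cong2[where f = "(+)"] coprod_cong, auto simp: coboundary_def)
      finally show ?thesis .
    qed
    then show "coboundary C (cup C \<phi> \<psi>) b =
        (cup C (coboundary C \<phi>) \<psi> + cup C \<phi> (coboundary C \<psi>)) b"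
      by (cases "b \<in> basis C") (auto simp: coboundary_def cup_def)
  qed
  show "cup C (cup C \<phi> \<psi>) \<theta> = cup C \<phi> (cup C \<psi> \<theta>)"
  proof
    fix b
    have "cup C (cup C \<phi> \<psi>) \<theta> b = cup C \<phi> (cup C \<psi> \<theta>) b" if b: "b \<in> basis C"
    proof -
      have "cup C (cup C \<phi> \<psi>) \<theta> b = lin (\<lambda>(t, z). (\<lambda>(x, y). \<phi> x * \<psi> y) t * \<theta> z)
          (tens_map (coprod C) gen (coprod C b))"
        unfolding lin_tens_map using b
        by (subst cup_def) (auto intro!: coprod_cong simp: cup_def)
      also have "\<dots> = lin (\<lambda>(x, t). \<phi> x * (\<lambda>(y, z). \<psi> y * \<theta> z) t)
          (assoc_map (tens_map (coprod C) gen (coprod C b)))"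
        unfolding assoc_map_def lin_lin_bit
        by (auto intro!: lin_cong simp: mult.assoc)
      also have "\<dots> = lin (\<lambda>(x, t). \<phi> x * (\<lambda>(y, z). \<psi> y * \<theta> z) t)
          (tens_map gen (coprod C) (coprod C b))"
        using assms b by (simp add: chain_coalgebra_def)
      also have "\<dots> = cup C \<phi> (cup C \<psi> \<theta>) b"
        unfolding lin_tens_map using b
        by (subst cup_def) (auto intro!: coprod_cong simp: cup_def)
      finally show ?thesis .
    qed
    then show "cup C (cup C \<phi> \<psi>) \<theta> b = cup C \<phi> (cup C \<psi> \<theta>) b"
      by (cases "b \<in> basis C") (auto simp: cup_def)
  qed
qed

section \<open>Chains, boundaries and exact cochains\<close>

lemma sum_closed:
  assumes "0 \<in> S" "\<And>u v. u \<in> S \<Longrightarrow> v \<in> S \<Longrightarrow> u + v \<in> S" "\<And>i. i \<in> I \<Longrightarrow> h i \<in> S"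
  shows "sum h I \<in> S"
  using assms(3) by (induction I rule: infinite_finite_induct) (auto intro: assms(1,2))

lemma chains_0 [simp]: "0 \<in> chains C n"
  by (simp add: chains_def)

lemma chains_add [intro]: "u \<in> chains C n \<Longrightarrow> v \<in> chains C n \<Longrightarrow> u + v \<in> chains C n"
  using Poly_Mapping.keys_add[of u v] by (auto simp: chains_def)

lemma chainsD: "c \<in> chains C n \<Longrightarrow> b \<in> Poly_Mapping.keys c \<Longrightarrow> b \<in> basis C \<and> deg C b = n"
  by (auto simp: chains_def)

lemma gen_in_chains: "b \<in> basis C \<Longrightarrow> gen b \<in> chains C (deg C b)"
  by (simp add: chains_def)

lemma lin_in_chains:
  "(\<And>b. b \<in> Poly_Mapping.keys c \<Longrightarrow> f b \<in> chains C n) \<Longrightarrow> lin f c \<in> chains C n"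
  unfolding lin_def by (rule sum_closed) auto

lemma has_dual_bd_0: "has_dual C \<Longrightarrow> b \<in> basis C \<Longrightarrow> deg C b = 0 \<Longrightarrow> bd C b = 0"
  by (simp add: has_dual_def)

lemma has_dual_bd_Suc:
  "has_dual C \<Longrightarrow> b \<in> basis C \<Longrightarrow> deg C b = Suc n \<Longrightarrow> bd C b \<in> chains C n"
  by (simp add: has_dual_def)

lemma has_dual_keys_bd: "has_dual C \<Longrightarrow> b \<in> basis C \<Longrightarrow> Poly_Mapping.keys (bd C b) \<subseteq> basis C"
  by (rule keys_bd) (auto simp: has_dual_def)

lemma lin_coboundary:
  assumes "c \<in> chains C n"
  shows "lin (coboundary C \<phi>) c = lin \<phi> (lin (bd C) c)"
  unfolding lin_lin_bit by (rule lin_cong) (use assms in \<open>auto dest: chainsD simp: coboundary_def\<close>)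

lemma lin_pullback:
  assumes "c \<in> chains C n"
  shows "lin (pullback C f \<phi>) c = lin \<phi> (lin f c)"
  unfolding lin_lin_bit by (rule lin_cong) (use assms in \<open>auto dest: chainsD simp: pullback_def\<close>)

lemma boundaries_0 [simp]: "0 \<in> boundaries C n"
  unfolding boundaries_def by (rule image_eqI[of _ _ 0]) auto

lemma boundaries_add: "u \<in> boundaries C n \<Longrightarrow> v \<in> boundaries C n \<Longrightarrow> u + v \<in> boundaries C n"
  unfolding boundaries_def by (auto simp flip: lin_add)

lemma vec2_diff [simp]: "u - v = u + v" for u v :: "'b vec2"
  by (simp add: diff_eq_eq add.assoc)

lemma vec2_add_eq_0_iff: "u + v = 0 \<longleftrightarrow> u = v" for u v :: "'b vec2"
  by (simp flip: vec2_diff)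

text \<open>Over a field, a cochain that vanishes on cycles factors through the differential:
  \<open>bd c \<mapsto> \<omega> c\<close> is well defined on boundaries and extends linearly to all
  vectors.\<close>

lemma exact_cochain:
  assumes "has_dual C" "\<omega> \<in> cochains C" and zero: "\<And>n z. z \<in> cycles C n \<Longrightarrow> lin \<omega> z = 0"
  shows "\<omega> \<in> coboundary C ` cochains C"
proof -
  have "\<exists>\<beta>. \<forall>c\<in>chains C n. lin \<beta> (lin (bd C) c) = lin \<omega> c" for n
  proof -
    define R where "R = (\<lambda>c. (lin (bd C) c, lin \<omega> c)) ` chains C n"
    obtain \<beta> where "\<And>x a. (x, a) \<in> R \<Longrightarrow> lin \<beta> x = a"
    proof (rule linear_graph_extends[of R])
      show "(x + y, a + b) \<in> R" if "(x, a) \<in> R" "(y, b) \<in> R" for x a y b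
        using that unfolding R_def by (auto simp flip: lin_add lin_add_bit)
      show "(0, 0) \<in> R" unfolding R_def by (rule image_eqI[of _ _ 0]) auto
      show "(0, 1) \<notin> R" using zero[of _ n] by (auto simp: R_def cycles_def)
    qed blast
    then show ?thesis unfolding R_def by blast
  qed
  then have "\<exists>\<beta>. \<forall>n. \<forall>c\<in>chains C n. lin (\<beta> n) (lin (bd C) c) = lin \<omega> c"
    by (intro choice allI)
  then obtain \<beta> where \<beta>: "\<And>n c. c \<in> chains C n \<Longrightarrow> lin (\<beta> n) (lin (bd C) c) = lin \<omega> c"
    by blast
  \<comment> \<open>\<open>\<beta> n\<close> is prescribed on boundaries of \<open>n\<close>-chains,
    which have degree \<open>n - 1\<close>; hence the shift by one.\<close>
  define \<gamma> where "\<gamma> b = (if b \<in> basis C then \<beta> (Suc (deg C b)) b else 0)" for b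
  have "coboundary C \<gamma> b = \<omega> b" for b
  proof (cases "b \<in> basis C")
    case b: True
    have "lin \<gamma> (bd C b) = lin (\<beta> (deg C b)) (bd C b)"
    proof (cases "deg C b")
      case 0
      then show ?thesis using assms(1) b by (simp add: has_dual_bd_0)
    next
      case (Suc n)
      then show ?thesis
        using has_dual_bd_Suc[OF assms(1) b Suc] by (intro lin_cong) (auto simp: \<gamma>_def dest!: chainsD)
    qed
    then show ?thesis
      using b \<beta>[OF gen_in_chains[OF b]] by (simp add: coboundary_def)
  qed (use assms(2) in \<open>simp add: coboundary_def cochains_def\<close>)
  then have "\<omega> = coboundary C \<gamma>" by auto
  then show ?thesis by (auto simp: cochains_def \<gamma>_def)
qed

section \<open>Quasi-isomorphisms of coalgebras and their duals\<close>

lemma homology_class_self: "z \<in> cycles C n \<Longrightarrow> z \<in> homology_class C n z"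
  by (simp add: homology_class_def)

lemma homology_class_eq: "z + z' \<in> boundaries C n \<Longrightarrow> homology_class C n z = homology_class C n z'"
  unfolding homology_class_def
  by (auto dest: boundaries_add[of "z + z'" C n] simp: ac_simps)

lemma coalg_hom_chains:
  "coalg_hom C D f \<Longrightarrow> c \<in> chains C n \<Longrightarrow> lin f c \<in> chains D n"
  by (rule lin_in_chains) (auto simp: coalg_hom_def dest!: chainsD)

lemma coalg_hom_bd:
  assumes "coalg_hom C D f" "c \<in> chains C n"
  shows "lin f (lin (bd C) c) = lin (bd D) (lin f c)"
  unfolding lin_lin by (rule lin_cong) (use assms in \<open>auto simp: coalg_hom_def dest!: chainsD\<close>)

lemma coalg_hom_boundaries:
  "coalg_hom C D f \<Longrightarrow> c \<in> boundaries C n \<Longrightarrow> lin f c \<in> boundaries D n"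
  unfolding boundaries_def by (auto simp: coalg_hom_bd intro: coalg_hom_chains)

lemma quasi_iso_surj:
  assumes "quasi_iso C D f" "z \<in> cycles D n"
  obtains y where "y \<in> cycles C n" "lin f y + z \<in> boundaries D n"
proof -
  have "homology_class D n z \<in> homology_map D n f ` homology C n"
    using assms by (auto simp: quasi_iso_def bij_betw_def homology_def)
  then obtain K where "K \<in> homology C n" "z \<in> homology_map D n f K"
    using homology_class_self[OF assms(2)] by auto
  then show ?thesis
    using that by (auto simp: homology_def homology_map_def homology_class_def add.commute)
qed

text \<open>The classes of \<open>z\<close> and \<open>0\<close> have the same image, so they agree.
  Since \<open>homology_map\<close> is a union over representatives, each representative is checked
  to land in the class of \<open>0\<close>.\<close>

lemma quasi_iso_inj:
  assumes qi: "quasi_iso C D f" and z: "z \<in> cycles C n" "lin f z \<in> boundaries D n"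
  shows "z \<in> boundaries C n"
proof -
  have hom: "coalg_hom C D f" using qi by (simp add: quasi_iso_def)
  have trivial: "homology_map D n f (homology_class C n y) = homology_class D n 0"
    if y: "y \<in> cycles C n" "lin f y \<in> boundaries D n" for y
  proof -
    have "homology_class D n (lin f x) = homology_class D n 0" if "x \<in> homology_class C n y" for x
    proof (rule homology_class_eq)
      have "lin f (x + y) \<in> boundaries D n"
        using that coalg_hom_boundaries[OF hom] by (simp add: homology_class_def del: lin_add)
      from boundaries_add[OF this y(2)] show "lin f x + 0 \<in> boundaries D n"
        by (simp add: add.assoc)
    qed
    then show ?thesis
      using homology_class_self[OF y(1)] unfolding homology_map_def by blast
  qed
  have 0: "0 \<in> cycles C n" by (simp add: cycles_def)
  have "homology_map D n f (homology_class C n z) = homology_map D n f (homology_class C n 0)"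
    using trivial z 0 by simp
  then have "homology_class C n z = homology_class C n 0"
    using qi z(1) 0 unfolding quasi_iso_def bij_betw_def homology_def
    by (meson imageI inj_onD)
  then show ?thesis
    using homology_class_self[OF z(1)] by (simp add: homology_class_def)
qed

lemma cochains_add: "\<phi> \<in> cochains C \<Longrightarrow> \<psi> \<in> cochains C \<Longrightarrow> \<phi> + \<psi> \<in> cochains C"
  by (simp add: cochains_def)

lemma pullback_coboundary:
  assumes "coalg_hom C D f" "has_dual C"
  shows "pullback C f (coboundary D \<phi>) = coboundary C (pullback C f \<phi>)"
proof
  fix b
  show "pullback C f (coboundary D \<phi>) b = coboundary C (pullback C f \<phi>) b"
  proof (cases "b \<in> basis C")
    case b: True
    have fb: "f b \<in> chains D (deg C b)" and bd: "lin f (bd C b) = lin (bd D) (f b)"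
      using assms(1) b by (auto simp: coalg_hom_def)
    have "lin (pullback C f \<phi>) (bd C b) = lin \<phi> (lin f (bd C b))"
      unfolding lin_lin_bit using has_dual_keys_bd[OF assms(2) b]
      by (intro lin_cong) (auto simp: pullback_def)
    then show ?thesis
      using b by (simp add: pullback_def[of C f "coboundary D \<phi>"] coboundary_def[of C]
          lin_coboundary[OF fb] bd)
  qed (simp add: pullback_def coboundary_def)
qed

lemma pullback_cup:
  assumes "coalg_hom C D f" "has_dual C"
  shows "pullback C f (cup D \<phi> \<psi>) = cup C (pullback C f \<phi>) (pullback C f \<psi>)"
proof
  fix b
  show "pullback C f (cup D \<phi> \<psi>) b = cup C (pullback C f \<phi>) (pullback C f \<psi>) b"
  proof (cases "b \<in> basis C")
    case b: True
    have fb: "f b \<in> chains D (deg C b)" and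
      coprod: "tens_map f f (coprod C b) = lin (coprod D) (f b)"
      using assms(1) b by (auto simp: coalg_hom_def)
    have keys: "Poly_Mapping.keys (coprod C b) \<subseteq> basis C \<times> basis C"
      using assms(2) b by (simp add: has_dual_def)
    have "lin (cup D \<phi> \<psi>) (f b) = lin (\<lambda>(x, y). \<phi> x * \<psi> y) (lin (coprod D) (f b))"
      unfolding lin_lin_bit using fb by (intro lin_cong) (auto simp: cup_def dest: chainsD)
    also have "\<dots> = lin (\<lambda>(x, y). lin \<phi> (f x) * lin \<psi> (f y)) (coprod C b)"
      by (simp add: lin_tens_map flip: coprod)
    also have "\<dots> = lin (\<lambda>(x, y). pullback C f \<phi> x * pullback C f \<psi> y) (coprod C b)"
      using keys by (intro lin_cong) (auto simp: pullback_def)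
    finally show ?thesis
      using b by (simp add: pullback_def[of C f "cup D \<phi> \<psi>"] cup_def[of C])
  qed (simp add: pullback_def cup_def)
qed

text \<open>In each degree a functional on \<open>D\<close> is prescribed to be \<phi> on images of
  cycles and 0 on boundaries. This is consistent: a cycle whose image bounds is itself a boundary,
  and \<phi> kills boundaries. The pullback then agrees with \<phi> on cycles, so
  \<open>exact_cochain\<close> applies.\<close>

lemma pullback_surj:
  assumes qi: "quasi_iso C D f" and C: "has_dual C" and D: "has_dual D"
    and \<phi>: "\<phi> \<in> cochains C" "coboundary C \<phi> = 0"
  shows "\<exists>\<psi>\<in>cochains D. coboundary D \<psi> = 0 \<and> pullback C f \<psi> + \<phi> \<in> coboundary C ` cochains C"
proof -
  have hom: "coalg_hom C D f" using qi by (simp add: quasi_iso_def)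
  have \<phi>_boundary: "lin \<phi> (lin (bd C) c) = 0" if "c \<in> chains C n" for c n
    using lin_coboundary[OF that, of \<phi>] \<phi>(2) by (simp add: lin_def)
  have "\<exists>\<psi>. (\<forall>z\<in>cycles C n. lin \<psi> (lin f z) = lin \<phi> z) \<and>
            (\<forall>e\<in>chains D (Suc n). lin \<psi> (lin (bd D) e) = 0)" for n
  proof -
    define R where
      "R = (\<lambda>(z, e). (lin f z + lin (bd D) e, lin \<phi> z)) ` (cycles C n \<times> chains D (Suc n))"
    have RI: "(lin f z + lin (bd D) e, lin \<phi> z) \<in> R"
      if "z \<in> cycles C n" "e \<in> chains D (Suc n)" for z e
      unfolding R_def by (rule image_eqI[of _ _ "(z, e)"]) (use that in auto)
    have cycles_add: "y + z \<in> cycles C n" if "y \<in> cycles C n" "z \<in> cycles C n" for y z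
      using that by (auto simp: cycles_def)
    have 0: "0 \<in> cycles C n" by (simp add: cycles_def)
    obtain \<psi> where \<psi>: "\<And>x a. (x, a) \<in> R \<Longrightarrow> lin \<psi> x = a"
    proof (rule linear_graph_extends[of R])
      show "(x + x', a + a') \<in> R" if xa: "(x, a) \<in> R" "(x', a') \<in> R" for x a x' a'
      proof -
        from xa obtain z e z' e' where "z \<in> cycles C n" "e \<in> chains D (Suc n)"
          "z' \<in> cycles C n" "e' \<in> chains D (Suc n)"
          "x = lin f z + lin (bd D) e" "a = lin \<phi> z"
          "x' = lin f z' + lin (bd D) e'" "a' = lin \<phi> z'"
          unfolding R_def by auto
        then show ?thesis
          using RI[OF cycles_add chains_add, of z z' e e'] by (simp add: ac_simps)
      qed
      show "(0, 0) \<in> R" using RI[OF 0 chains_0] by simp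
      show "(0, 1) \<notin> R"
      proof
        assume "(0, 1) \<in> R"
        then obtain z e where z: "z \<in> cycles C n" and e: "e \<in> chains D (Suc n)"
          and "lin f z + lin (bd D) e = 0" and "lin \<phi> z = 1"
          unfolding R_def by auto
        then have "z \<in> boundaries C n"
          using e by (intro quasi_iso_inj[OF qi z]) (auto simp: boundaries_def vec2_add_eq_0_iff)
        then show False
          using \<phi>_boundary \<open>lin \<phi> z = 1\<close> by (auto simp: boundaries_def)
      qed
    qed blast
    show ?thesis
    proof (intro exI[of _ \<psi>] conjI ballI)
      show "lin \<psi> (lin f z) = lin \<phi> z" if "z \<in> cycles C n" for z
        using \<psi>[OF RI[OF that chains_0]] by simp
      show "lin \<psi> (lin (bd D) e) = 0" if "e \<in> chains D (Suc n)" for e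
        using \<psi>[OF RI[OF 0 that]] by simp
    qed
  qed
  then have "\<exists>\<psi>'. \<forall>n. (\<forall>z\<in>cycles C n. lin (\<psi>' n) (lin f z) = lin \<phi> z) \<and>
            (\<forall>e\<in>chains D (Suc n). lin (\<psi>' n) (lin (bd D) e) = 0)"
    by (intro choice allI)
  then obtain \<psi>' where \<psi>': "\<And>n z. z \<in> cycles C n \<Longrightarrow> lin (\<psi>' n) (lin f z) = lin \<phi> z"
    "\<And>n e. e \<in> chains D (Suc n) \<Longrightarrow> lin (\<psi>' n) (lin (bd D) e) = 0"
    by blast
  define \<psi> where "\<psi> b = (if b \<in> basis D then \<psi>' (deg D b) b else 0)" for b
  have lin_\<psi>: "lin \<psi> c = lin (\<psi>' n) c" if "c \<in> chains D n" for c n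
    using that by (intro lin_cong) (auto simp: \<psi>_def dest: chainsD)
  have \<psi>: "\<psi> \<in> cochains D" by (simp add: cochains_def \<psi>_def)
  have "coboundary D \<psi> b = 0" for b
  proof (cases "b \<in> basis D")
    case b: True
    show ?thesis
    proof (cases "deg D b")
      case 0
      then show ?thesis using D b by (simp add: has_dual_bd_0 coboundary_def)
    next
      case (Suc n)
      then have "lin (\<psi>' n) (bd D b) = 0"
        using \<psi>'(2)[of "gen b" n] gen_in_chains[OF b] by simp
      then show ?thesis
        using b lin_\<psi>[OF has_dual_bd_Suc[OF D b Suc]] by (simp add: coboundary_def)
    qed
  qed (simp add: coboundary_def)
  then have "coboundary D \<psi> = 0" by auto
  moreover have "pullback C f \<psi> + \<phi> \<in> coboundary C ` cochains C"
  proof (rule exact_cochain[OF C])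
    show "pullback C f \<psi> + \<phi> \<in> cochains C"
      using \<phi>(1) by (simp add: cochains_def pullback_def)
    fix n z assume z: "z \<in> cycles C n"
    then have zc: "z \<in> chains C n" by (simp add: cycles_def)
    have "lin (pullback C f \<psi>) z = lin \<phi> z"
      using \<psi>'(1)[OF z] lin_\<psi>[OF coalg_hom_chains[OF hom zc]] by (simp add: lin_pullback[OF zc])
    then show "lin (pullback C f \<psi> + \<phi>) z = 0"
      by (simp add: lin_plus_fun)
  qed
  ultimately show ?thesis using \<psi> by blast
qed

text \<open>Every cycle of \<open>D\<close> is the image of a cycle of \<open>C\<close> plus a
  boundary, and \<omega> vanishes on both summands.\<close>

lemma pullback_inj:
  assumes qi: "quasi_iso C D f" and C: "has_dual C" and D: "has_dual D"
    and \<omega>: "\<omega> \<in> cochains D" "coboundary D \<omega> = 0"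
    and exact: "pullback C f \<omega> \<in> coboundary C ` cochains C"
  shows "\<omega> \<in> coboundary D ` cochains D"
proof (rule exact_cochain[OF D \<omega>(1)])
  have hom: "coalg_hom C D f" using qi by (simp add: quasi_iso_def)
  fix n z assume "z \<in> cycles D n"
  then obtain y e where y: "y \<in> cycles C n" and e: "e \<in> chains D (Suc n)"
    and eq: "lin f y + z = lin (bd D) e"
    by (rule quasi_iso_surj[OF qi]) (auto simp: boundaries_def)
  have z: "z = lin f y + lin (bd D) e"
    by (simp flip: eq)
  obtain \<alpha> where \<alpha>: "pullback C f \<omega> = coboundary C \<alpha>" using exact by blast
  have yc: "y \<in> chains C n" "lin (bd C) y = 0" using y by (auto simp: cycles_def)
  have "lin \<omega> (lin f y) = 0"
    unfolding lin_pullback[OF yc(1), symmetric] \<alpha> lin_coboundary[OF yc(1)] yc(2) by simp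
  moreover have "lin \<omega> (lin (bd D) e) = 0"
    unfolding lin_coboundary[OF e, symmetric] \<omega>(2) by (simp add: lin_def)
  ultimately show "lin \<omega> z = 0" by (simp add: z)
qed

section \<open>Invariance of the obstruction along zigzags\<close>

definition dual_obstructed :: "'b coalg \<Rightarrow> bool" where
  "dual_obstructed C \<longleftrightarrow> dg_algebra2.obstructed (cochains C) (cup C) (coboundary C)"

lemma dual_obstructed_quasi_iso:
  assumes qi: "quasi_iso C D f" and C: "has_dual C" and D: "has_dual D"
  shows "dual_obstructed C \<longleftrightarrow> dual_obstructed D"
proof -
  have hom: "coalg_hom C D f" using qi by (simp add: quasi_iso_def)
  interpret C: dg_algebra2 "cochains C" "cup C" "coboundary C" using C by (simp add: has_dual_def)
  interpret D: dg_algebra2 "cochains D" "cup D" "coboundary D" using D by (simp add: has_dual_def)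
  \<comment> \<open>Dualising reverses the arrow, so the cochains of \<open>D\<close> form the
    source algebra.\<close>
  interpret dg_quasi_iso2 "cochains D" "cup D" "coboundary D" "cochains C" "cup C" "coboundary C"
    "pullback C f"
  proof unfold_locales
    show "pullback C f \<phi> \<in> cochains C" for \<phi> by (simp add: cochains_def pullback_def)
    show "pullback C f (\<phi> + \<psi>) = pullback C f \<phi> + pullback C f \<psi>" for \<phi> \<psi>
      by (auto simp: pullback_def fun_eq_iff lin_plus_fun)
  qed (use pullback_cup[OF hom C] pullback_coboundary[OF hom C]
      pullback_inj[OF qi C D] pullback_surj[OF qi C D] in auto)
  show ?thesis unfolding dual_obstructed_def by (simp add: obstructed_iff)
qed

lemma dual_obstructed_linked:
  assumes "qi_linked C D" "has_dual C" "has_dual D"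
  shows "dual_obstructed C \<longleftrightarrow> dual_obstructed D"
  using assms(1) unfolding qi_linked_def
proof (elim disjE exE)
  show ?thesis if "quasi_iso C D f" for f
    using dual_obstructed_quasi_iso[OF that] assms by simp
  show ?thesis if "quasi_iso D C g" for g
    using dual_obstructed_quasi_iso[OF that] assms by simp
qed

lemma dual_obstructed_homotopy_type:
  fixes T :: "'c itself"
  assumes "same_homotopy_type T C D" "has_dual C" "has_dual D"
  shows "dual_obstructed C \<longleftrightarrow> dual_obstructed D"
proof -
  obtain n and E :: "nat \<Rightarrow> 'c coalg" where E: "\<forall>i\<le>n. chain_coalgebra (E i)" "qi_linked C (E 0)"
    "\<forall>i<n. qi_linked (E i) (E (Suc i))" "qi_linked (E n) D"
    using assms(1) unfolding same_homotopy_type_def by blast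
  have hd: "has_dual (E i)" if "i \<le> n" for i
    using E(1) that has_dual_chain_coalgebra by blast
  have "dual_obstructed (E 0) \<longleftrightarrow> dual_obstructed (E i)" if "i \<le> n" for i
    using that
  proof (induction i)
    case (Suc i)
    then show ?case using dual_obstructed_linked[of "E i" "E (Suc i)"] E(3) hd by simp
  qed simp
  then have "dual_obstructed (E 0) \<longleftrightarrow> dual_obstructed (E n)" by blast
  then show ?thesis
    using dual_obstructed_linked[OF E(2)] dual_obstructed_linked[OF E(4)] hd assms(2,3) by simp
qed

section \<open>The obstruction for the coalgebra \<open>M\<close>\<close>

lemma dual_obstructed_M: "dual_obstructed coalg_M"
proof -
  interpret dg_algebra2 "cochains coalg_M" "cup coalg_M" "coboundary coalg_M"
    using has_dual_chain_coalgebra[OF chain_coalgebra_M] by (simp add: has_dual_def)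
  define e :: "M_basis \<Rightarrow> M_basis \<Rightarrow> bit" where "e b = (\<lambda>c. if c = b then 1 else 0)" for b
  note defs = coalg_M_def M_bd_def M_coprod_def M_redcoprod_def
  \<comment> \<open>Both the coboundary of \<open>e x3\<close> and the square of \<open>e u2\<close>
    are \<open>e v4\<close>. The choice \<open>S = 0\<close> works because no coproduct contains
    \<open>(u2, z3)\<close> or \<open>(z3, u2)\<close>.\<close>
  have system: "obstruction_system (e u2) (e z3) (e x3) 0"
    unfolding obstruction_system_def fun_eq_iff
  proof (intro conjI allI)
    show "coboundary coalg_M (e u2) b = 0 b" "coboundary coalg_M (e z3) b = 0 b"
      "coboundary coalg_M (e x3) b = cup coalg_M (e u2) (e u2) b"
      "coboundary coalg_M 0 b = (cup coalg_M (e u2) (e z3) + cup coalg_M (e z3) (e u2)) b" for b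
      by (cases b; simp add: defs e_def coboundary_def cup_def)+
  qed (simp_all add: cochains_def coalg_M_def)
  \<comment> \<open>The coproduct of \<open>w6\<close> contains \<open>(x3, z3)\<close> but not
    \<open>(z3, x3)\<close>, so exactly one of the two products of \<open>e x3\<close> and
    \<open>e z3\<close> is nonzero there.\<close>
  have "obstruction (e u2) (e z3) (e x3) 0 w6 = 1"
    unfolding obstruction_def by (simp add: defs e_def cup_def)
  moreover have "coboundary coalg_M \<beta> w6 = 0" for \<beta>
    by (simp add: defs coboundary_def)
  ultimately have "obstruction (e u2) (e z3) (e x3) 0 \<notin> coboundary coalg_M ` cochains coalg_M"
    by force
  with system show ?thesis unfolding dual_obstructed_def obstructed_def by blast
qed

section \<open>Normalized singular cochains\<close>

text \<open>Here the recursion is turned back into a sum over positions, to be matched with the sum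
  over faces in \<open>normalized_chains\<close>.\<close>

lemma lcobd_sum: "lcobd F vs = (\<Sum>k<length vs. F (take k vs @ drop (Suc k) vs))"
  by (induction vs arbitrary: F) (simp_all add: sum.lessThan_Suc_shift del: sum.lessThan_Suc)

lemma lcup_sum: "lcup F G vs = (\<Sum>k<length vs. F (take (Suc k) vs) * G (drop k vs))"
  by (induction vs arbitrary: F) (simp_all add: sum.lessThan_Suc_shift del: sum.lessThan_Suc)

text \<open>The affine map of standard simplices that sends vertex \<open>l\<close> to vertex \<open>vs ! l\<close>. Vertices
  beyond \<open>n\<close> are replaced by \<open>n\<close>, so that every nonempty list is admissible.\<close>

definition vertex_map :: "nat \<Rightarrow> nat list \<Rightarrow> (nat \<Rightarrow> real) \<Rightarrow> nat \<Rightarrow> real" where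
  "vertex_map n vs t = (\<lambda>k. \<Sum>l<length vs. if min n (vs ! l) = k then t l else 0)"

text \<open>The face or degeneracy of \<open>s\<close> with vertex list \<open>vs\<close>. Truncated
  subtraction gives the empty list dimension 0, so lists are assumed nonempty where it
  matters.\<close>

definition pull :: "'a simplex \<Rightarrow> nat list \<Rightarrow> 'a simplex" where
  "pull s vs = (length vs - 1,
     restrict (\<lambda>t. snd s (vertex_map (fst s) vs t)) (standard_simplex (length vs - 1)))"

lemma vertex_map_in_standard_simplex:
  assumes "vs \<noteq> []" "t \<in> standard_simplex (length vs - 1)"
  shows "vertex_map n vs t \<in> standard_simplex n"
proof -
  have t: "0 \<le> t l" for l using assms(2) by (simp add: standard_simplex_def)
  have "{..length vs - 1} = {..<length vs}" using assms(1) by (cases vs) auto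
  then have sum_t: "(\<Sum>l<length vs. t l) = 1" using assms(2) by (simp add: standard_simplex_def)
  \<comment> \<open>Because of the clamping by \<open>min n\<close>, each coordinate
    \<open>t l\<close> contributes to exactly one \<open>k \<le> n\<close>.\<close>
  have "(\<Sum>k\<le>n. vertex_map n vs t k) = (\<Sum>l<length vs. t l)"
    unfolding vertex_map_def by (subst sum.swap) (simp add: sum.delta)
  moreover have "0 \<le> vertex_map n vs t k" for k
    unfolding vertex_map_def by (intro sum_nonneg) (simp add: t)
  moreover have "vertex_map n vs t k \<le> 1" for k
    unfolding vertex_map_def sum_t[symmetric] by (intro sum_mono) (simp add: t)
  moreover have "vertex_map n vs t k = 0" if "k > n" for k
    unfolding vertex_map_def using that by (intro sum.neutral) auto
  ultimately show ?thesis using sum_t by (simp add: standard_simplex_def)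
qed

lemma continuous_vertex_map:
  "continuous_map (powertop_real UNIV) (powertop_real UNIV) (vertex_map n vs)"
proof -
  have "continuous_map (powertop_real UNIV) euclideanreal (\<lambda>t. if b then t l else 0)" for b and l :: nat
    by (cases b) (auto intro: continuous_map_product_projection)
  then show ?thesis
    unfolding continuous_map_componentwise_UNIV vertex_map_def
    by (intro allI continuous_map_sum) auto
qed

lemma singular_simplex_pull:
  assumes "singular_simplex n X \<sigma>" "vs \<noteq> []"
  shows "singular_simplex (length vs - 1) X (snd (pull (n, \<sigma>) vs))"
proof -
  let ?S = "\<lambda>n. subtopology (powertop_real UNIV) (standard_simplex n)"
  have "continuous_map (?S (length vs - 1)) (?S n) (vertex_map n vs)"
    using continuous_map_from_subtopology[OF continuous_vertex_map]
      vertex_map_in_standard_simplex[OF assms(2)]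
    by (auto simp: continuous_map_in_subtopology)
  then have "continuous_map (?S (length vs - 1)) X (\<sigma> \<circ> vertex_map n vs)"
    using assms(1) continuous_map_compose unfolding singular_simplex_def by blast
  then have "continuous_map (?S (length vs - 1)) X (snd (pull (n, \<sigma>) vs))"
    by (rule continuous_map_eq) (auto simp: pull_def)
  then show ?thesis
    by (simp add: singular_simplex_def pull_def)
qed

text \<open>Affine maps compose as their vertex assignments do; the inner \<open>min\<close> is the
  clamping of the entries of \<open>ws\<close>.\<close>

lemma vertex_map_vertex_map:
  assumes "vs \<noteq> []"
  shows "vertex_map n vs (vertex_map (length vs - 1) ws t) =
    vertex_map n (map (\<lambda>i. vs ! min (length vs - 1) i) ws) t"
proof
  fix k
  let ?m = "length vs - 1"
  have "vertex_map n vs (vertex_map ?m ws t) k =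
      (\<Sum>l<length vs. \<Sum>j<length ws. if min ?m (ws ! j) = l then
         (if min n (vs ! l) = k then t j else 0) else 0)"
    unfolding vertex_map_def by (intro sum.cong) (auto intro!: sum.cong sum.neutral)
  also have "\<dots> = (\<Sum>j<length ws. if min n (vs ! min ?m (ws ! j)) = k then t j else 0)"
    using assms by (subst sum.swap) (auto intro!: sum.cong simp: sum.delta min_def)
  also have "\<dots> = vertex_map n (map (\<lambda>i. vs ! min ?m i) ws) t k"
    unfolding vertex_map_def by simp
  finally show "vertex_map n vs (vertex_map ?m ws t) k = \<dots>" .
qed

lemma fst_pull [simp]: "fst (pull s vs) = length vs - 1"
  by (simp add: pull_def)

lemma pull_pull:
  assumes "vs \<noteq> []" "ws \<noteq> []"
  shows "pull (pull s vs) ws = pull s (map (\<lambda>i. vs ! min (length vs - 1) i) ws)"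
  using vertex_map_in_standard_simplex[OF assms(2), of _ "length vs - 1"] assms
  by (auto simp: pull_def vertex_map_vertex_map simp del: One_nat_def intro!: restrict_ext)

lemma standard_simplex_zero: "t \<in> standard_simplex n \<Longrightarrow> k > n \<Longrightarrow> t k = 0"
  by (simp add: standard_simplex_def)

lemma vertex_map_upt:
  assumes "j \<le> n" "i \<le> j" "t \<in> standard_simplex (j - i)"
  shows "vertex_map n [i..<Suc j] t = (\<lambda>k. if k < i then 0 else t (k - i))"
proof
  fix k
  have "vertex_map n [i..<Suc j] t k = (\<Sum>l<Suc j - i. if l = k - i then (if k < i then 0 else t l) else 0)"
    unfolding vertex_map_def length_upt using assms(1,2)
    by (intro sum.cong) (auto simp: min_def simp del: upt_Suc)
  also have "\<dots> = (if k < i then 0 else t (k - i))"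
    using assms(2) standard_simplex_zero[OF assms(3), of "k - i"] by (auto simp: sum.delta)
  finally show "vertex_map n [i..<Suc j] t k = (if k < i then 0 else t (k - i))" .
qed

lemma front_face_eq_pull: "i \<le> n \<Longrightarrow> front_face i (n, \<sigma>) = pull (n, \<sigma>) [0..<Suc i]"
  using vertex_map_upt[of i n 0]
  by (auto simp: front_face_def pull_def simp del: upt_Suc intro!: restrict_ext)

lemma back_face_eq_pull: "i \<le> n \<Longrightarrow> back_face i (n, \<sigma>) = pull (n, \<sigma>) [i..<Suc n]"
  using vertex_map_upt[of n n i]
  by (auto simp: back_face_def pull_def Suc_diff_le simp del: upt_Suc intro!: restrict_ext)

lemma pull_upt: "singular_simplex n X \<sigma> \<Longrightarrow> pull (n, \<sigma>) [0..<Suc n] = (n, \<sigma>)"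
  using front_face_eq_pull[of n n \<sigma>]
  by (simp add: front_face_def singular_simplex_def extensional_restrict del: upt_Suc)

lemma singular_face_eq_pull:
  assumes "0 < n" "k \<le> n"
  shows "(n - 1, singular_face n k \<sigma>) = pull (n, \<sigma>) (take k [0..<Suc n] @ drop (Suc k) [0..<Suc n])"
proof -
  let ?vs = "take k [0..<Suc n] @ drop (Suc k) [0..<Suc n]"
  have vs: "?vs = [0..<k] @ [Suc k..<Suc n]"
    using assms by (simp add: take_upt drop_upt del: upt_Suc)
  have len: "length ?vs = n" unfolding vs using assms by (simp del: upt_Suc)
  have nth: "?vs ! l = (if l < k then l else Suc l)" if "l < n" for l
    unfolding vs using that assms by (simp add: nth_append del: upt_Suc)
  have "vertex_map n ?vs t = simplical_face k t" if t: "t \<in> standard_simplex (n - 1)" for t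
  proof
    fix i
    \<comment> \<open>Position \<open>l\<close> carries vertex \<open>i\<close> when
      \<open>l = i < k\<close> or \<open>l = i - 1\<close> with \<open>i > k\<close>; the vertex
      \<open>i = k\<close> is never hit.\<close>
    have "vertex_map n ?vs t i =
        (\<Sum>l<n. if l = (if i < k then i else i - 1) then (if i = k then 0 else t l) else 0)"
      unfolding vertex_map_def len using nth assms by (intro sum.cong) auto
    also have "\<dots> = simplical_face k t i"
      using assms standard_simplex_zero[OF t, of i] standard_simplex_zero[OF t, of "i - 1"]
      by (auto simp: simplical_face_def sum.delta)
    finally show "vertex_map n ?vs t i = simplical_face k t i" .
  qed
  then show ?thesis
    unfolding pull_def len singular_face_def by (auto intro!: restrict_ext)
qed

text \<open>The degeneracy operator at vertex \<open>j\<close> of a \<open>p\<close>-simplex, as a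
  vertex list.\<close>

definition repeat_vertex :: "nat \<Rightarrow> nat \<Rightarrow> nat list" where
  "repeat_vertex p j = [0..<j] @ j # j # [Suc j..<Suc p]"

lemma simplicial_degen_eq_vertex_map:
  assumes "j \<le> p" and t: "t \<in> standard_simplex (Suc p)"
  shows "vertex_map p (repeat_vertex p j) t = simplicial_degen j t"
proof
  fix i
  have len: "length (repeat_vertex p j) = Suc (Suc p)"
    using assms(1) by (simp add: repeat_vertex_def del: upt_Suc)
  have nth: "repeat_vertex p j ! l = (if l \<le> j then l else l - 1)" if "l < Suc (Suc p)" for l
    using that assms(1) by (auto simp: repeat_vertex_def nth_append nth_Cons' simp del: upt_Suc)
  \<comment> \<open>Vertex \<open>i\<close> sits at position \<open>i\<close> if
    \<open>i \<le> j\<close> and at position \<open>Suc i\<close> if \<open>j \<le> i\<close>; for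
    \<open>i = j\<close> both coordinates are added.\<close>
  have "vertex_map p (repeat_vertex p j) t i =
      (\<Sum>l<Suc (Suc p). (if l = i then (if i \<le> j then t l else 0) else 0) +
                         (if l = Suc i then (if j \<le> i then t l else 0) else 0))"
    unfolding vertex_map_def len using nth assms(1) by (intro sum.cong) auto
  also have "\<dots> = simplicial_degen j t i"
    using assms(1) standard_simplex_zero[OF t, of "Suc i"]
    by (auto simp: sum.distrib simplicial_degen_def simp del: sum.lessThan_Suc)
  finally show "vertex_map p (repeat_vertex p j) t i = simplicial_degen j t i" .
qed

lemma degenerate_iff:
  "degenerate X s \<longleftrightarrow>
     (\<exists>p \<tau> j. j \<le> p \<and> singular_simplex p X \<tau> \<and> s = pull (p, \<tau>) (repeat_vertex p j))"
proof -
  have *: "pull (p, \<tau>) (repeat_vertex p j) =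
      (Suc p, restrict (\<tau> \<circ> simplicial_degen j) (standard_simplex (Suc p)))" if "j \<le> p"
    for p j and \<tau> :: "(nat \<Rightarrow> real) \<Rightarrow> 'a"
  proof -
    have "length (repeat_vertex p j) = Suc (Suc p)"
      using that by (simp add: repeat_vertex_def del: upt_Suc)
    then show ?thesis
      using simplicial_degen_eq_vertex_map[OF that] by (auto simp: pull_def intro!: restrict_ext)
  qed
  show ?thesis unfolding degenerate_def by (simp add: * cong: conj_cong)
qed

text \<open>Merging the equal neighbours gives a shorter list \<open>ws\<close>, and the given list
  is \<open>ws\<close> composed with the degeneracy at position \<open>length us\<close>.\<close>

lemma degenerate_pull:
  assumes "singular_simplex n X \<sigma>"
  shows "degenerate X (pull (n, \<sigma>) (us @ v # v # vs))"
proof -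
  define ws where "ws = us @ v # vs"
  let ?p = "length ws - 1" and ?j = "length us"
  have ws: "ws \<noteq> []" "?j \<le> ?p" by (auto simp: ws_def)
  have p: "?p = ?j + length vs" by (simp add: ws_def)
  let ?f = "\<lambda>i. ws ! min ?p i"
  have "map ?f [0..<?j] = us"
    by (rule nth_equalityI) (simp_all add: p ws_def nth_append min_absorb2)
  moreover have "?f ?j = v"
    by (simp add: p ws_def min_absorb2)
  moreover have "map ?f [Suc ?j..<Suc ?p] = vs"
    by (rule nth_equalityI) (simp_all add: p ws_def nth_append min_absorb2 del: upt_Suc)
  ultimately have "map ?f (repeat_vertex ?p ?j) = us @ v # v # vs"
    by (simp add: repeat_vertex_def del: upt_Suc)
  then have "pull (n, \<sigma>) (us @ v # v # vs) = pull (pull (n, \<sigma>) ws) (repeat_vertex ?p ?j)"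
    using ws by (subst pull_pull) (auto simp: repeat_vertex_def)
  moreover have "pull (n, \<sigma>) ws = (?p, snd (pull (n, \<sigma>) ws))"
    by (simp add: prod_eq_iff)
  ultimately show ?thesis
    unfolding degenerate_iff using singular_simplex_pull[OF assms ws(1)] ws(2)
    by (intro exI[of _ ?p] exI[of _ "snd (pull (n, \<sigma>) ws)"] exI[of _ ?j]) simp
qed

section \<open>From cochains on a space to cochains on vertex lists\<close>

text \<open>The cochain \<phi> pulled back along \<open>s\<close> to the full simplex on its
  vertices. The value 0 at the empty list makes the two extra terms of \<open>lcobd_lcup\<close>
  vanish.\<close>

definition evaluate :: "('a simplex \<Rightarrow> bit) \<Rightarrow> 'a simplex \<Rightarrow> nat lcochain" where
  "evaluate \<phi> s vs = (if vs = [] then 0 else \<phi> (pull s vs))"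

definition is_simplex :: "'a topology \<Rightarrow> 'a simplex \<Rightarrow> bool" where
  "is_simplex X s \<longleftrightarrow> singular_simplex (fst s) X (snd s)"

lemma is_simplex_pull: "is_simplex X s \<Longrightarrow> vs \<noteq> [] \<Longrightarrow> is_simplex X (pull s vs)"
  unfolding is_simplex_def using singular_simplex_pull[of "fst s" X "snd s" vs] by simp

lemma basis_normalized_chains:
  "s \<in> basis (normalized_chains X) \<longleftrightarrow> is_simplex X s \<and> \<not> degenerate X s"
  by (cases s) (simp add: normalized_chains_def is_simplex_def)

lemma cochainsD: "\<phi> \<in> cochains C \<Longrightarrow> b \<notin> basis C \<Longrightarrow> \<phi> b = 0"
  unfolding cochains_def by blast

lemma cochain_degenerate: "\<phi> \<in> cochains (normalized_chains X) \<Longrightarrow> degenerate X s \<Longrightarrow> \<phi> s = 0"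
  by (erule cochainsD) (simp add: basis_normalized_chains)

lemma lin_nd_class:
  "\<phi> \<in> cochains (normalized_chains X) \<Longrightarrow> lin \<phi> (nd_class X s) = \<phi> s"
  by (simp add: nd_class_def cochain_degenerate)

lemma evaluate_pull:
  "vs \<noteq> [] \<Longrightarrow> evaluate \<phi> (pull s vs) = (\<lambda>ws. evaluate \<phi> s (map (\<lambda>i. vs ! min (length vs - 1) i) ws))"
  by (auto simp: evaluate_def pull_pull)

lemma lnormalized_evaluate:
  assumes "\<phi> \<in> cochains (normalized_chains X)" "is_simplex X s"
  shows "lnormalized (evaluate \<phi> s)"
  unfolding lnormalized_def evaluate_def
  using cochain_degenerate[OF assms(1)] degenerate_pull[of "fst s" X "snd s"] assms(2)
  by (simp add: is_simplex_def)

lemma map_nth_min: "map (\<lambda>i. vs ! min (length vs - 1) i) [0..<length vs] = vs"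
  by (rule nth_equalityI) (auto simp: min_absorb2)

lemma evaluate_top: "is_simplex X s \<Longrightarrow> evaluate \<phi> s [0..<Suc (fst s)] = \<phi> s"
  using pull_upt[of "fst s" X "snd s"] by (simp add: evaluate_def is_simplex_def)

text \<open>On a nondegenerate simplex the conclusion is naturality; on a degenerate one both sides
  vanish because \<open>K\<close> preserves normalization.\<close>

lemma evaluate_operation:
  fixes K :: "nat lcochain \<Rightarrow> nat lcochain \<Rightarrow> nat lcochain"
  assumes natural: "\<And>F G g vs. K F G (map g vs) = K (\<lambda>us. F (map g us)) (\<lambda>us. G (map g us)) vs"
    and normal: "\<And>F G. lnormalized F \<Longrightarrow> lnormalized G \<Longrightarrow> lnormalized (K F G)"
    and nil: "\<And>F G. K F G [] = 0"
    and \<phi>: "\<phi> \<in> cochains (normalized_chains X)" and \<psi>: "\<psi> \<in> cochains (normalized_chains X)"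
    and \<omega>: "\<omega> \<in> cochains (normalized_chains X)"
    and eq: "\<And>s. s \<in> basis (normalized_chains X) \<Longrightarrow>
               \<omega> s = K (evaluate \<phi> s) (evaluate \<psi> s) [0..<Suc (fst s)]"
    and s: "is_simplex X s"
  shows "evaluate \<omega> s = K (evaluate \<phi> s) (evaluate \<psi> s)"
proof
  \<comment> \<open>The vertices of \<open>pull t vs\<close> are the entries of \<open>vs\<close>,
    so by naturality evaluation on all of its vertices is evaluation at \<open>vs\<close>.\<close>
  have K_pull: "K (evaluate \<phi> (pull t vs)) (evaluate \<psi> (pull t vs)) [0..<Suc (fst (pull t vs))] =
      K (evaluate \<phi> t) (evaluate \<psi> t) vs" if "vs \<noteq> []" for t vs
  proof -
    have "Suc (fst (pull t vs)) = length vs" using that by simp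
    then show ?thesis
      unfolding evaluate_pull[OF that] natural[symmetric] by (simp only: map_nth_min)
  qed
  fix vs
  show "evaluate \<omega> s vs = K (evaluate \<phi> s) (evaluate \<psi> s) vs"
  proof (cases "vs = [] \<or> \<not> degenerate X (pull s vs)")
    case True
    have "\<omega> (pull s vs) = K (evaluate \<phi> s) (evaluate \<psi> s) vs" if ne: "vs \<noteq> []"
      unfolding K_pull[OF ne, symmetric] using True is_simplex_pull[OF s ne] ne
      by (intro eq) (simp add: basis_normalized_chains)
    then show ?thesis
      by (simp add: evaluate_def nil)
  next
    case False
    \<comment> \<open>Degeneracy of the face does not force a repeated entry in \<open>vs\<close>.
      The face is therefore rewritten as a degeneracy of \<tau>, whose vertex list does repeat one,
      and \<open>K_pull\<close> is applied to both descriptions.\<close>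
    then obtain p \<tau> j where "j \<le> p" and \<tau>: "singular_simplex p X \<tau>"
      and dup: "pull s vs = pull (p, \<tau>) (repeat_vertex p j)" and ne: "vs \<noteq> []"
      by (auto simp: degenerate_iff)
    have "lnormalized (K (evaluate \<phi> (p, \<tau>)) (evaluate \<psi> (p, \<tau>)))"
      using \<tau> \<phi> \<psi> by (intro normal lnormalized_evaluate) (auto simp: is_simplex_def)
    then have "K (evaluate \<phi> (p, \<tau>)) (evaluate \<psi> (p, \<tau>)) (repeat_vertex p j) = 0"
      unfolding repeat_vertex_def by (rule lnormalizedD)
    then have "K (evaluate \<phi> s) (evaluate \<psi> s) vs = 0"
      using K_pull[OF ne, of s] K_pull[of "repeat_vertex p j" "(p, \<tau>)"]
      unfolding dup by (simp add: repeat_vertex_def del: upt_Suc)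
    then show ?thesis
      using False cochain_degenerate[OF \<omega>] by (simp add: evaluate_def)
  qed
qed

lemma lin_sum: "lin \<phi> (sum h I) = (\<Sum>i\<in>I. lin \<phi> (h i))" for \<phi> :: "'b \<Rightarrow> bit"
  by (rule additive_sum) simp_all

lemma coboundary_in_cochains: "coboundary C \<phi> \<in> cochains C"
  by (simp add: cochains_def coboundary_def)

lemma cup_in_cochains: "cup C \<phi> \<psi> \<in> cochains C"
  by (simp add: cochains_def cup_def)

text \<open>Discarding degenerate faces by \<open>nd_class\<close> is invisible to \<phi>, which
  vanishes on them.\<close>

lemma coboundary_normalized_chains:
  assumes \<phi>: "\<phi> \<in> cochains (normalized_chains X)" and s: "s \<in> basis (normalized_chains X)"
  shows "coboundary (normalized_chains X) \<phi> s = lcobd (evaluate \<phi> s) [0..<Suc (fst s)]"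
proof -
  obtain n \<sigma> where ns: "s = (n, \<sigma>)" by (cases s)
  show ?thesis
  proof (cases "n = 0")
    \<comment> \<open>On a vertex both sides are 0, the right one because \<open>evaluate\<close> is
      0 at the empty list.\<close>
    case True
    then show ?thesis
      using s by (simp add: coboundary_def normalized_chains_def ns evaluate_def)
  next
    case False
    have "coboundary (normalized_chains X) \<phi> s = (\<Sum>k\<le>n. \<phi> (n - 1, singular_face n k \<sigma>))"
      using s False by (simp add: coboundary_def)
        (simp add: normalized_chains_def ns lin_sum lin_nd_class[OF \<phi>])
    also have "\<dots> = (\<Sum>k\<le>n. evaluate \<phi> s (take k [0..<Suc n] @ drop (Suc k) [0..<Suc n]))"
    proof (rule sum.cong[OF refl])
      fix k assume k: "k \<in> {..n}"
      have "length (take k [0..<Suc n] @ drop (Suc k) [0..<Suc n]) = n"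
        using k by (simp del: upt_Suc)
      then have "take k [0..<Suc n] @ drop (Suc k) [0..<Suc n] \<noteq> []"
        using False by (metis list.size(3))
      then show "\<phi> (n - 1, singular_face n k \<sigma>) =
          evaluate \<phi> s (take k [0..<Suc n] @ drop (Suc k) [0..<Suc n])"
        using False k singular_face_eq_pull[of n k \<sigma>] by (simp only: evaluate_def ns if_False) simp
    qed
    also have "\<dots> = lcobd (evaluate \<phi> s) [0..<Suc n]"
      by (simp add: lcobd_sum lessThan_Suc_atMost del: upt_Suc)
    finally show ?thesis by (simp add: ns)
  qed
qed

lemma cup_normalized_chains:
  assumes \<phi>: "\<phi> \<in> cochains (normalized_chains X)" and \<psi>: "\<psi> \<in> cochains (normalized_chains X)"
    and s: "s \<in> basis (normalized_chains X)"
  shows "cup (normalized_chains X) \<phi> \<psi> s = lcup (evaluate \<phi> s) (evaluate \<psi> s) [0..<Suc (fst s)]"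
proof -
  obtain n \<sigma> where ns: "s = (n, \<sigma>)" by (cases s)
  have "cup (normalized_chains X) \<phi> \<psi> s = (\<Sum>i\<le>n. \<phi> (front_face i s) * \<psi> (back_face i s))"
    using s by (simp add: cup_def)
      (simp add: normalized_chains_def ns lin_sum lin_tens lin_nd_class[OF \<phi>] lin_nd_class[OF \<psi>])
  also have "\<dots> = (\<Sum>i\<le>n. evaluate \<phi> s (take (Suc i) [0..<Suc n]) * evaluate \<psi> s (drop i [0..<Suc n]))"
    by (rule sum.cong)
       (simp_all add: ns evaluate_def front_face_eq_pull back_face_eq_pull take_upt drop_upt del: upt_Suc)
  also have "\<dots> = lcup (evaluate \<phi> s) (evaluate \<psi> s) [0..<Suc n]"
    by (simp add: lcup_sum lessThan_Suc_atMost del: upt_Suc)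
  finally show ?thesis by (simp add: ns)
qed

text \<open>Steenrod's cup-1 product of singular cochains. The value 0 off the basis is consistent
  with the list formula because \<open>lcup1\<close> preserves normalization.\<close>

definition cup1 :: "'a topology \<Rightarrow> ('a simplex \<Rightarrow> bit) \<Rightarrow> ('a simplex \<Rightarrow> bit) \<Rightarrow> 'a simplex \<Rightarrow> bit" where
  "cup1 X \<phi> \<psi> s = (if s \<in> basis (normalized_chains X)
     then lcup1 (evaluate \<phi> s) (evaluate \<psi> s) [0..<Suc (fst s)] else 0)"

lemma cup1_in_cochains: "cup1 X \<phi> \<psi> \<in> cochains (normalized_chains X)"
  by (simp add: cochains_def cup1_def)

context
  fixes X :: "'a topology" and s :: "'a simplex"
  assumes s: "is_simplex X s"
begin

lemma evaluate_coboundary: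
  assumes "\<phi> \<in> cochains (normalized_chains X)"
  shows "evaluate (coboundary (normalized_chains X) \<phi>) s = lcobd (evaluate \<phi> s)"
  by (rule evaluate_operation[where K = "\<lambda>F G. lcobd F", OF _ _ _ assms assms coboundary_in_cochains
        coboundary_normalized_chains[OF assms] s])
     (auto simp: lcobd_map)

lemma evaluate_cup:
  assumes "\<phi> \<in> cochains (normalized_chains X)" "\<psi> \<in> cochains (normalized_chains X)"
  shows "evaluate (cup (normalized_chains X) \<phi> \<psi>) s = lcup (evaluate \<phi> s) (evaluate \<psi> s)"
  by (rule evaluate_operation[where K = lcup, OF _ _ _ assms cup_in_cochains
        cup_normalized_chains[OF assms] s])
     (auto simp: lcup_map)

lemma evaluate_cup1:
  assumes "\<phi> \<in> cochains (normalized_chains X)" "\<psi> \<in> cochains (normalized_chains X)"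
  shows "evaluate (cup1 X \<phi> \<psi>) s = lcup1 (evaluate \<phi> s) (evaluate \<psi> s)"
  by (rule evaluate_operation[where K = lcup1, OF _ _ _ assms cup1_in_cochains _ s])
     (auto simp: lcup1_map cup1_def)

end

lemma evaluate_Nil [simp]: "evaluate \<phi> s [] = 0"
  by (simp add: evaluate_def)

lemma evaluate_add: "evaluate (\<phi> + \<psi>) s = (\<lambda>vs. evaluate \<phi> s vs + evaluate \<psi> s vs)"
  by (auto simp: evaluate_def)

lemma evaluate_zero: "evaluate 0 s = (\<lambda>_. 0)"
  by (auto simp: evaluate_def)

text \<open>Evaluation at the full vertex list recovers the value on \<open>s\<close>, so identities
  of cochains reduce to identities on lists.\<close>

lemma cochain_eqI:
  assumes "\<phi> \<in> cochains (normalized_chains X)" "\<psi> \<in> cochains (normalized_chains X)"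
    and "\<And>s vs. is_simplex X s \<Longrightarrow> evaluate \<phi> s vs = evaluate \<psi> s vs"
  shows "\<phi> = \<psi>"
proof
  fix s
  show "\<phi> s = \<psi> s"
  proof (cases "s \<in> basis (normalized_chains X)")
    case True
    then have s: "is_simplex X s" by (simp add: basis_normalized_chains)
    then show ?thesis using assms(3) evaluate_top[OF s] by metis
  qed (simp add: cochainsD[OF assms(1)] cochainsD[OF assms(2)])
qed

lemma has_dual_normalized_chains: "has_dual (normalized_chains X)"
proof (rule has_dualI)
  let ?N = "normalized_chains X"
  fix s assume s: "s \<in> basis ?N"
  obtain n \<sigma> where ns: "s = (n, \<sigma>)" by (cases s)
  have \<sigma>: "singular_simplex n X \<sigma>" using s by (simp add: basis_normalized_chains is_simplex_def ns)
  show "bd ?N s = 0" if "deg ?N s = 0" using that by (simp add: ns normalized_chains_def)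
  have nd_class: "Poly_Mapping.keys (nd_class X t) \<subseteq> {t} \<inter> basis ?N" if "is_simplex X t" for t
    using that by (auto simp: nd_class_def basis_normalized_chains)
  show "bd ?N s \<in> chains ?N m" if m: "deg ?N s = Suc m" for m
  proof -
    have n: "n = Suc m" using m by (simp add: ns normalized_chains_def)
    have "nd_class X (m, singular_face n k \<sigma>) \<in> chains ?N m" if "k \<le> n" for k
      using nd_class[of "(m, singular_face n k \<sigma>)"] singular_simplex_singular_face[OF \<sigma>, of k] that n
      by (auto simp: chains_def is_simplex_def normalized_chains_def)
    then have "(\<Sum>k\<le>n. nd_class X (m, singular_face n k \<sigma>)) \<in> chains ?N m"
      by (intro sum_closed) auto
    then show ?thesis by (simp add: ns normalized_chains_def n)
  qed
  have "nd_class X (front_face i s) \<otimes>\<^sub>2 nd_class X (back_face i s) \<in>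
      {c. Poly_Mapping.keys c \<subseteq> basis ?N \<times> basis ?N}" if "i \<le> n" for i
  proof -
    have "is_simplex X s" using \<sigma> by (simp add: ns is_simplex_def)
    then have "is_simplex X (front_face i s)" "is_simplex X (back_face i s)"
      unfolding ns front_face_eq_pull[OF that] back_face_eq_pull[OF that]
      by (rule is_simplex_pull; use that in simp)+
    then show ?thesis
      by (auto simp: nd_class_def basis_normalized_chains)
  qed
  then have "(\<Sum>i\<le>n. nd_class X (front_face i s) \<otimes>\<^sub>2 nd_class X (back_face i s)) \<in>
      {c. Poly_Mapping.keys c \<subseteq> basis ?N \<times> basis ?N}"
    by (intro sum_closed) (auto dest: subsetD[OF Poly_Mapping.keys_add])
  then show "Poly_Mapping.keys (coprod ?N s) \<subseteq> basis ?N \<times> basis ?N"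
    by (simp add: normalized_chains_def ns)
next
  let ?N = "normalized_chains X"
  note closed = cup_in_cochains coboundary_in_cochains cochains_add
  note ev = evaluate_cup evaluate_coboundary evaluate_add evaluate_zero
  have zero: "0 \<in> cochains ?N" by (simp add: cochains_def)
  fix \<phi> \<psi> \<theta> assume *: "\<phi> \<in> cochains ?N"
  show "coboundary ?N (coboundary ?N \<phi>) = 0"
    by (rule cochain_eqI[OF closed(2) zero]) (simp add: ev closed * lcobd_lcobd)
  assume **: "\<psi> \<in> cochains ?N"
  \<comment> \<open>The list formula has two extra terms; they vanish by
    \<open>evaluate_Nil\<close>.\<close>
  show "coboundary ?N (cup ?N \<phi> \<psi>) = cup ?N (coboundary ?N \<phi>) \<psi> + cup ?N \<phi> (coboundary ?N \<psi>)"
    by (rule cochain_eqI[of _ X]) (simp_all add: ev closed * ** lcobd_lcup)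
  assume "\<theta> \<in> cochains ?N"
  then show "cup ?N (cup ?N \<phi> \<psi>) \<theta> = cup ?N \<phi> (cup ?N \<psi> \<theta>)"
    by (intro cochain_eqI[of _ X]) (simp_all add: ev closed * ** lcup_assoc)
qed

section \<open>Vanishing of the obstruction for spaces\<close>

lemma not_dual_obstructed_normalized_chains: "\<not> dual_obstructed (normalized_chains X)"
proof -
  let ?N = "normalized_chains X"
  interpret dg_algebra2 "cochains ?N" "cup ?N" "coboundary ?N"
    using has_dual_normalized_chains[of X] by (simp add: has_dual_def)
  have "obstruction U Z Y S \<in> coboundary ?N ` cochains ?N" if sys: "obstruction_system U Z Y S"
    for U Z Y S
  proof -
    note sys = sys[unfolded obstruction_system_def]
    have mem: "U \<in> cochains ?N" "Z \<in> cochains ?N" "Y \<in> cochains ?N" "S \<in> cochains ?N"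
      using sys by auto
    define T where "T = cup1 X Y Z + cup1 X U S + cup1 X U (cup1 X U Z)"
    have T: "T \<in> cochains ?N" unfolding T_def by (simp add: cup1_in_cochains)
    have "obstruction U Z Y S = coboundary ?N T"
    proof (rule cochain_eqI)
      show "obstruction U Z Y S \<in> cochains ?N" unfolding obstruction_def using mem by simp
      show "coboundary ?N T \<in> cochains ?N" using T by simp
      fix s vs assume s: "is_simplex X s"
      note ev = evaluate_cup[OF s] evaluate_cup1[OF s] evaluate_add evaluate_zero
      \<comment> \<open>Reversed, so that the hypotheses of \<open>lobstruction\<close> on
        \<open>lcobd\<close> become evaluated equations of the system.\<close>
      note d = evaluate_coboundary[OF s, symmetric]
      have "lcobd (evaluate T s) vs = lcup (evaluate Y s) (evaluate Z s) vs
          + lcup (evaluate Z s) (evaluate Y s) vs + lcup (evaluate U s) (evaluate S s) vs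
          + lcup (evaluate S s) (evaluate U s) vs"
        unfolding T_def ev(3) ev(2)[OF mem(3,2)] ev(2)[OF mem(1,4)]
          ev(2)[OF mem(1) cup1_in_cochains] ev(2)[OF mem(1,2)]
        by (rule lobstruction) (use sys mem in \<open>simp_all add: d ev\<close>)
      then show "evaluate (obstruction U Z Y S) s vs = evaluate (coboundary ?N T) s vs"
        unfolding obstruction_def by (simp add: ev mem evaluate_coboundary[OF s T])
    qed
    then show ?thesis using T by blast
  qed
  then show ?thesis unfolding dual_obstructed_def obstructed_def by blast
qed

theorem proposition5p10:
  fixes X :: "'a topology"
  shows "\<not> same_homotopy_type TYPE('c) coalg_M (normalized_chains X)"
  using dual_obstructed_homotopy_type[of "TYPE('c)" coalg_M "normalized_chains X"]
    has_dual_chain_coalgebra[OF chain_coalgebra_M] has_dual_normalized_chains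
    dual_obstructed_M not_dual_obstructed_normalized_chains by blast

end
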